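(* Let $N\in\mathbb{N}$, let $\alpha\in(-\infty,\min\{2,N\})$, and let $D\in C(\mathbb{R}^N)$ satisfy $D(x)>0$ for all $x$ and $\lim_{|x|\to\infty}\big(|x|^{-\alpha}D(x)\big)=D_0$ for some constant $D_0>0$. Then for every $\sigma\in(0,\frac{N-\alpha}{2})$ there exist a function $\overline{U}_{D,\sigma}\in C^2(\overline{\Omega}\times[0,\infty))$ that is a supersolution of the problem $\partial_tU-D(x)\Delta U=0$, $U(x,0)=w(x)$, with initial value $w(x)=\langle x\rangle^{-2\sigma}$, and positive constants $c_{D,\sigma}$, $C_{D,\sigma}$, $C'_{D,\sigma}$ such that for all $(x,t)\in\overline{\Omega}\times[0,\infty)$ $$c_{D,\sigma}\left(1+t+\langle x\rangle^{2-\alpha}\right)^{-\frac{2\sigma}{2-\alpha}}\le \overline{U}_{D,\sigma}(x,t)\le C_{D,\sigma}\left(1+t+\langle x\rangle^{2-\alpha}\right)^{-\frac{2\sigma}{2-\alpha}},$$ $$|\partial_t\overline{U}_{D,\sigma}(x,t)|\le C'_{D,\sigma}\left(1+t+\langle x\rangle^{2-\alpha}\right)^{-\frac{2\sigma}{2-\alpha}-1}.$$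
   Context: $\langle x\rangle=\sqrt{1+|x|^2}$. $\Omega\subset\mathbb{R}^N$ is a domain with smooth boundary such that $\mathbb{R}^N\setminus\Omega$ is compact (an exterior domain); $\Omega=\mathbb{R}^N$ is allowed, in which case the boundary condition below is void. For $w\in C(\Omega)$, a function $\overline{U}\in C^2(\overline{\Omega}\times[0,\infty))$ is called a supersolution of the problem $\partial_tU-D(x)\Delta U=0$, $U(x,0)=w(x)$, if $\partial_t\overline{U}(x,t)-D(x)\Delta\overline{U}(x,t)\ge 0$ for $(x,t)\in\Omega\times(0,\infty)$, $\overline{U}(x,t)\ge 0$ for $(x,t)\in\partial\Omega\times(0,\infty)$, and $\overline{U}(x,0)\ge w(x)$ for $x\in\Omega$. *)

theory Defs
  imports "HOL-Analysis.Analysis"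
begin

text \<open>
  \<open>Ck_upto k S T f\<close>, for open \<open>S\<close> and \<open>S \<subseteq> T \<subseteq> closure S\<close>: all derivatives of \<open>f\<close> of order at
  most \<open>k\<close> exist on \<open>S\<close> and extend continuously to \<open>T\<close>, the extension of \<open>f\<close> being \<open>f\<close> itself.
  With \<open>T = S\<close> this is the class of k times continuously differentiable functions on \<open>S\<close>; with
  \<open>T = closure S\<close> it is the class of functions that are k times continuously differentiable up to
  the boundary. Below, \<open>g\<close> is the extension of the derivative in the direction \<open>v\<close>.
\<close>

primrec Ck_upto :: "nat \<Rightarrow> 'a::euclidean_space set \<Rightarrow> 'a set \<Rightarrow> ('a \<Rightarrow> real) \<Rightarrow> bool" where
  "Ck_upto 0 S T f \<longleftrightarrow> continuous_on T f"
| "Ck_upto (Suc k) S T f \<longleftrightarrow>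
     continuous_on T f \<and> (\<forall>x\<in>S. f differentiable (at x)) \<and>
     (\<forall>v. \<exists>g. (\<forall>x\<in>S. g x = frechet_derivative f (at x) v) \<and> Ck_upto k S T g)"

definition smooth_on :: "'a::euclidean_space set \<Rightarrow> ('a \<Rightarrow> real) \<Rightarrow> bool" where
  "smooth_on S f \<longleftrightarrow> (\<forall>k. Ck_upto k S S f)"

text \<open>
  Near each boundary point, after relabelling and reorienting the coordinate axes, the set is the
  region above the graph of a smooth function of the other coordinates. That function is encoded
  as a function \<open>\<gamma>\<close> on the whole space that does not depend on the \<open>i\<close>-th coordinate.
\<close>

definition smooth_boundary :: "(real ^ 'n) set \<Rightarrow> bool" where
  "smooth_boundary \<Omega> \<longleftrightarrow>
     (\<forall>p\<in>frontier \<Omega>. \<exists>r>0. \<exists>i. \<exists>s\<in>{1, -1}. \<exists>\<gamma>.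
        smooth_on UNIV \<gamma> \<and>
        (\<forall>x y. (\<forall>j. j \<noteq> i \<longrightarrow> x $ j = y $ j) \<longrightarrow> \<gamma> x = \<gamma> y) \<and>
        \<Omega> \<inter> ball p r = {x \<in> ball p r. s * (x $ i) > \<gamma> x})"

definition exterior_domain :: "(real ^ 'n) set \<Rightarrow> bool" where
  "exterior_domain \<Omega> \<longleftrightarrow>
     open \<Omega> \<and> connected \<Omega> \<and> \<Omega> \<noteq> {} \<and> smooth_boundary \<Omega> \<and> compact (- \<Omega>)"

definition japanese :: "real ^ 'n \<Rightarrow> real" where
  "japanese x = sqrt (1 + (norm x)\<^sup>2)"

definition partial_deriv :: "'n \<Rightarrow> (real ^ 'n \<Rightarrow> real) \<Rightarrow> real ^ 'n \<Rightarrow> real" where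
  "partial_deriv i f x = deriv (\<lambda>s. f (x + s *\<^sub>R axis i 1)) 0"

definition laplacian :: "(real ^ 'n \<Rightarrow> real) \<Rightarrow> real ^ 'n \<Rightarrow> real" where
  "laplacian f x = (\<Sum>i\<in>UNIV. partial_deriv i (partial_deriv i f) x)"

text \<open>The derivative in time is one-sided at \<open>t = 0\<close> and the ordinary one for \<open>t > 0\<close>.\<close>

definition time_deriv :: "((real ^ 'n) \<times> real \<Rightarrow> real) \<Rightarrow> real ^ 'n \<Rightarrow> real \<Rightarrow> real" where
  "time_deriv U x t = vector_derivative (\<lambda>s. U (x, s)) (at t within {0..})"

definition supersolution ::
  "(real ^ 'n) set \<Rightarrow> (real ^ 'n \<Rightarrow> real) \<Rightarrow> (real ^ 'n \<Rightarrow> real) \<Rightarrow> ((real ^ 'n) \<times> real \<Rightarrow> real) \<Rightarrow> bool"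
  where
  "supersolution \<Omega> D w U \<longleftrightarrow>
     Ck_upto 2 (\<Omega> \<times> {0<..}) (closure \<Omega> \<times> {0..}) U \<and>
     (\<forall>x\<in>\<Omega>. \<forall>t>0. time_deriv U x t - D x * laplacian (\<lambda>y. U (y, t)) x \<ge> 0) \<and>
     (\<forall>x\<in>frontier \<Omega>. \<forall>t>0. U (x, t) \<ge> 0) \<and>
     (\<forall>x\<in>\<Omega>. U (x, 0) \<ge> w x)"

end

theory Submission
  imports Defs "HOL-Real_Asymp.Real_Asymp"
begin

text \<open>
  Put \<open>p = 2 - \<alpha>\<close> and \<open>\<beta> = 2 * \<sigma> / p\<close>, so that \<open>0 < \<beta> < (N - \<alpha>) / p\<close>, and fix \<open>\<gamma>\<close> strictly between
  \<open>\<beta>\<close> and \<open>(N - \<alpha>) / p\<close>.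

  The supersolution has the form \<open>U (x, t) = M * f (1 + t) (A x)\<close>. The weight \<open>A\<close> is positive,
  grows like \<open>|x| powr p\<close>, and satisfies \<open>D \<Delta>A \<ge> \<gamma>\<close> and \<open>D |\<nabla>A|\<^sup>2 \<le> A\<close> everywhere; this is
  \<open>weight_exists\<close>. At infinity \<open>D\<close> is close to \<open>D\<^sub>0 |x| powr \<alpha>\<close>, and a multiple of
  \<open>(1 + |x|\<^sup>2) powr (p / 2)\<close> has both properties with room to spare, because \<open>\<gamma> < (N - \<alpha>) / p\<close>.
  On the remaining ball the first property is enforced by adding a large multiple of the strictly
  subharmonic function \<open>(1 + |x|\<^sup>2) powr (\<theta> / 2)\<close>, with \<open>max 0 (2 - N) < \<theta> < min 2 p\<close>, which is of
  lower order at infinity, and the second one by adding a constant.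

  If \<open>f\<close> is nonincreasing and convex in its second argument \<open>b\<close>, the two properties of \<open>A\<close> reduce
  the differential inequality for \<open>U\<close> to \<open>f\<^sub>\<tau> - \<gamma> f\<^sub>b - b f\<^sub>b\<^sub>b \<ge> 0\<close> for \<open>\<tau> > 0\<close>, \<open>b \<ge> 0\<close>. With
  \<open>K = 2 \<beta> (\<beta> + 2)\<close> and a small \<open>\<epsilon> > 0\<close>, this holds for
  \<open>f \<tau> b = \<tau> powr (-\<beta>) exp (- b / \<tau>) + \<epsilon> ((\<tau> + b) powr (-\<beta>) + K \<tau> (\<tau> + b) powr (-\<beta> - 1))\<close>
  (\<open>profile_supersolution\<close>). The Gaussian summand alone gives the left-hand side
  \<open>(\<gamma> - \<beta>) \<tau> powr (-\<beta> - 1) exp (- b / \<tau>)\<close>. The algebraic summand is a supersolution where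
  \<open>b / \<tau>\<close> is large, and where \<open>b / \<tau>\<close> is bounded its defect is at most a multiple of
  \<open>\<epsilon> \<tau> powr (-\<beta> - 1)\<close>, which the Gaussian summand absorbs. Since \<open>f\<close> lies between
  multiples of \<open>(\<tau> + b) powr (-\<beta>)\<close> and \<open>|f\<^sub>\<tau>|\<close> is at most a multiple of \<open>(\<tau> + b) powr (-\<beta> - 1)\<close>, the
  required bounds follow from the growth of \<open>A\<close>. The shift \<open>\<tau> = 1 + t\<close> makes \<open>U\<close> smooth on
  \<open>\<real>\<^sup>N \<times> (-1, \<infinity>)\<close>, which contains the closed space-time domain, so that regularity up to
  the boundary is immediate.
\<close>

section \<open>Functions of class C^k\<close>

lemma Ck_upto_restrict:
  assumes "Ck_upto k W W f" "S \<subseteq> W" "T \<subseteq> W"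
  shows "Ck_upto k S T f"
  using assms(1)
proof (induction k arbitrary: f)
  case 0
  then show ?case using assms(3) by (auto intro: continuous_on_subset)
next
  case (Suc k)
  have f: "continuous_on W f" "\<forall>x\<in>W. f differentiable (at x)"
    "\<forall>v. \<exists>g. (\<forall>x\<in>W. g x = frechet_derivative f (at x) v) \<and> Ck_upto k W W g"
    using Suc.prems by simp_all
  have "\<exists>g. (\<forall>x\<in>S. g x = frechet_derivative f (at x) v) \<and> Ck_upto k S T g" for v
  proof -
    obtain g where "\<forall>x\<in>W. g x = frechet_derivative f (at x) v" "Ck_upto k W W g"
      using f(3) by blast
    then show ?thesis using Suc.IH assms(2) by blast
  qed
  then show ?case using f(1,2) assms(2,3) by (auto intro: continuous_on_subset)
qed

lemma Ck_upto_SucD: "Ck_upto (Suc k) S T f \<Longrightarrow> Ck_upto k S T f"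
proof (induction k arbitrary: f)
  case (Suc k)
  then show ?case unfolding Ck_upto.simps(2)[of "Suc k"] Ck_upto.simps(2)[of k] by blast
qed auto

lemma Ck_upto_continuous_on: "Ck_upto k S T f \<Longrightarrow> continuous_on T f"
  by (cases k) auto

text \<open>
  An introduction and an elimination rule in which \<open>f' v x\<close> denotes the derivative at \<open>x\<close> in the
  direction \<open>v\<close>. At points of \<open>T\<close> outside of \<open>S\<close> it denotes the continuous extension of that
  derivative.
\<close>

lemma Ck_upto_SucI:
  assumes "continuous_on T f"
    and "\<And>x. x \<in> S \<Longrightarrow> (f has_derivative (\<lambda>v. f' v x)) (at x)"
    and "\<And>v. Ck_upto k S T (f' v)"
  shows "Ck_upto (Suc k) S T f"
proof -
  have "frechet_derivative f (at x) v = f' v x" if "x \<in> S" for x v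
    using frechet_derivative_at[OF assms(2)[OF that]] by metis
  then show ?thesis
    using assms by (auto intro: differentiableI)
qed

lemma Ck_upto_SucE:
  assumes "Ck_upto (Suc k) S T f"
  obtains f' where "\<And>x. x \<in> S \<Longrightarrow> (f has_derivative (\<lambda>v. f' v x)) (at x)"
    and "\<And>v. Ck_upto k S T (f' v)"
proof -
  have "\<forall>v. \<exists>g. (\<forall>x\<in>S. g x = frechet_derivative f (at x) v) \<and> Ck_upto k S T g"
    using assms by simp
  then obtain f' where f': "\<And>v x. x \<in> S \<Longrightarrow> f' v x = frechet_derivative f (at x) v"
      "\<And>v. Ck_upto k S T (f' v)"
    by metis
  show ?thesis
  proof (rule that)
    fix x assume x: "x \<in> S"
    then have "f differentiable at x" using assms by simp
    then have "(f has_derivative frechet_derivative f (at x)) (at x)"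
      by (simp add: frechet_derivative_works)
    then show "(f has_derivative (\<lambda>v. f' v x)) (at x)" using f'(1)[OF x] by simp
  qed (rule f'(2))
qed

lemma Ck_upto_const: "Ck_upto k S T (\<lambda>x. c)"
proof (induction k arbitrary: c)
  case (Suc k)
  show ?case by (rule Ck_upto_SucI[where f' = "\<lambda>v x. 0"]) (auto intro: Suc)
qed auto

lemma Ck_upto_bounded_linear:
  assumes "bounded_linear f"
  shows "Ck_upto k S T f"
proof (cases k)
  case 0
  then show ?thesis using assms by (simp add: linear_continuous_on)
next
  case (Suc m)
  show ?thesis unfolding Suc
    by (rule Ck_upto_SucI[where f' = "\<lambda>v x. f v"])
      (auto intro: Ck_upto_const linear_continuous_on bounded_linear_imp_has_derivative assms)
qed

lemma Ck_upto_add: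
  assumes "Ck_upto k S T f" "Ck_upto k S T g"
  shows "Ck_upto k S T (\<lambda>x. f x + g x)"
  using assms
proof (induction k arbitrary: f g)
  case 0
  then show ?case by (auto intro: continuous_intros)
next
  case (Suc k)
  obtain f' where f': "\<And>x. x \<in> S \<Longrightarrow> (f has_derivative (\<lambda>v. f' v x)) (at x)"
    "\<And>v. Ck_upto k S T (f' v)" using Ck_upto_SucE[OF Suc.prems(1)] by blast
  obtain g' where g': "\<And>x. x \<in> S \<Longrightarrow> (g has_derivative (\<lambda>v. g' v x)) (at x)"
    "\<And>v. Ck_upto k S T (g' v)" using Ck_upto_SucE[OF Suc.prems(2)] by blast
  show ?case
  proof (rule Ck_upto_SucI)
    show "continuous_on T (\<lambda>x. f x + g x)"
      using Suc.prems by (auto intro: continuous_intros)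
    show "((\<lambda>x. f x + g x) has_derivative (\<lambda>v. f' v x + g' v x)) (at x)" if "x \<in> S" for x
      using f'(1)[OF that] g'(1)[OF that] by (rule has_derivative_add)
    show "Ck_upto k S T (\<lambda>x. f' v x + g' v x)" for v
      using f'(2) g'(2) by (rule Suc.IH)
  qed
qed

lemma Ck_upto_mult:
  assumes "Ck_upto k S T f" "Ck_upto k S T g"
  shows "Ck_upto k S T (\<lambda>x. f x * g x)"
  using assms
proof (induction k arbitrary: f g)
  case 0
  then show ?case by (auto intro: continuous_intros)
next
  case (Suc k)
  obtain f' where f': "\<And>x. x \<in> S \<Longrightarrow> (f has_derivative (\<lambda>v. f' v x)) (at x)"
    "\<And>v. Ck_upto k S T (f' v)" using Ck_upto_SucE[OF Suc.prems(1)] by blast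
  obtain g' where g': "\<And>x. x \<in> S \<Longrightarrow> (g has_derivative (\<lambda>v. g' v x)) (at x)"
    "\<And>v. Ck_upto k S T (g' v)" using Ck_upto_SucE[OF Suc.prems(2)] by blast
  show ?case
  proof (rule Ck_upto_SucI)
    show "continuous_on T (\<lambda>x. f x * g x)"
      using Suc.prems by (auto intro: continuous_intros)
    show "((\<lambda>x. f x * g x) has_derivative (\<lambda>v. f x * g' v x + f' v x * g x)) (at x)"
      if "x \<in> S" for x
      using f'(1)[OF that] g'(1)[OF that] by (rule has_derivative_mult)
    show "Ck_upto k S T (\<lambda>x. f x * g' v x + f' v x * g x)" for v
      by (rule Ck_upto_add[OF Suc.IH[OF Ck_upto_SucD[OF Suc.prems(1)] g'(2)]
            Suc.IH[OF f'(2) Ck_upto_SucD[OF Suc.prems(2)]]])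
  qed
qed

lemma Ck_upto_sum:
  assumes "finite I" "\<And>i. i \<in> I \<Longrightarrow> Ck_upto k S T (f i)"
  shows "Ck_upto k S T (\<lambda>x. \<Sum>i\<in>I. f i x)"
  using assms by (induction I rule: finite_induct) (auto intro: Ck_upto_const Ck_upto_add)

text \<open>
  Composition with a real function, stated for a family \<open>\<Phi>\<close> that is closed under
  differentiation, so that each member is smooth.
\<close>

lemma Ck_upto_compose:
  assumes deriv: "\<And>\<phi>. \<phi> \<in> \<Phi> \<Longrightarrow>
      \<exists>\<psi>\<in>\<Phi>. \<forall>y\<in>I. (\<phi> has_real_derivative \<psi> y) (at y)"
    and "\<phi> \<in> \<Phi>" "Ck_upto k S T f" "S \<subseteq> T" "f ` T \<subseteq> I"
  shows "Ck_upto k S T (\<lambda>x. \<phi> (f x))"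
  using assms(2,3)
proof (induction k arbitrary: \<phi>)
  have cont: "continuous_on T (\<lambda>x. \<phi> (f x))"
    if "\<phi> \<in> \<Phi>" "Ck_upto k S T f" for \<phi> k
  proof (rule continuous_on_compose2[OF _ Ck_upto_continuous_on[OF that(2)] assms(5)])
    from deriv[OF that(1)] obtain \<psi> where
      "\<forall>y\<in>I. (\<phi> has_real_derivative \<psi> y) (at y)" by blast
    then show "continuous_on I \<phi>"
      by (auto intro!: continuous_at_imp_continuous_on intro: DERIV_isCont[of _ "\<psi> _"])
  qed
  {
    case 0
    then show ?case using cont[of \<phi> 0] by simp
  next
    case (Suc k)
    from deriv[OF Suc.prems(1)] obtain \<psi> where \<psi>: "\<psi> \<in> \<Phi>"
      "\<And>y. y \<in> I \<Longrightarrow> (\<phi> has_real_derivative \<psi> y) (at y)" by blast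
    obtain f' where f': "\<And>x. x \<in> S \<Longrightarrow> (f has_derivative (\<lambda>v. f' v x)) (at x)"
      "\<And>v. Ck_upto k S T (f' v)" using Ck_upto_SucE[OF Suc.prems(2)] by blast
    show ?case
    proof (rule Ck_upto_SucI)
      show "continuous_on T (\<lambda>x. \<phi> (f x))" using Suc.prems by (rule cont)
      show "((\<lambda>x. \<phi> (f x)) has_derivative (\<lambda>v. \<psi> (f x) * f' v x)) (at x)"
        if "x \<in> S" for x
      proof -
        have "(\<phi> has_derivative (*) (\<psi> (f x))) (at (f x))"
          using \<psi>(2)[of "f x"] that assms(4,5) by (auto simp: has_field_derivative_def)
        from has_derivative_compose[OF f'(1)[OF that] this] show ?thesis .
      qed
      show "Ck_upto k S T (\<lambda>x. \<psi> (f x) * f' v x)" for v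
        by (rule Ck_upto_mult[OF Suc.IH[OF \<psi>(1) Ck_upto_SucD[OF Suc.prems(2)]] f'(2)])
    qed
  }
qed

lemma Ck_upto_exp:
  assumes "Ck_upto k S T f" "S \<subseteq> T"
  shows "Ck_upto k S T (\<lambda>x. exp (f x))"
  by (rule Ck_upto_compose[where \<Phi> = "{exp}" and I = UNIV and \<phi> = exp])
    (use assms DERIV_exp in auto)

lemma Ck_upto_powr:
  assumes "Ck_upto k S T f" "S \<subseteq> T" "\<And>x. x \<in> T \<Longrightarrow> f x > 0"
  shows "Ck_upto k S T (\<lambda>x. f x powr a)"
proof (rule Ck_upto_compose[where \<Phi> = "{\<lambda>y. c * y powr a | c a. True}" and I = "{0<..}"
      and \<phi> = "\<lambda>y. y powr a"])
  fix \<phi> :: "real \<Rightarrow> real"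
  assume "\<phi> \<in> {\<lambda>y. c * y powr a | c a. True}"
  then obtain c a where \<phi>: "\<phi> = (\<lambda>y. c * y powr a)" by blast
  have "\<forall>y\<in>{0<..}. (\<phi> has_real_derivative (c * a) * y powr (a - 1)) (at y)"
    unfolding \<phi> by (auto intro!: derivative_eq_intros)
  then show "\<exists>\<psi>\<in>{\<lambda>y. c * y powr a | c a. True}.
      \<forall>y\<in>{0<..}. (\<phi> has_real_derivative \<psi> y) (at y)"
    by (intro bexI[of _ "\<lambda>y. (c * a) * y powr (a - 1)"]) blast+
next
  show "(\<lambda>y. y powr a) \<in> {\<lambda>y::real. c * y powr a | c a. True}"
    by (intro CollectI exI[of _ "1::real"] exI[of _ a]) auto
qed (use assms in auto)

section \<open>The Laplacian of a radial function\<close>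

lemma laplacian_radial:
  fixes x :: "real ^ 'n"
  assumes \<phi>: "\<And>q. q \<ge> 0 \<Longrightarrow> (\<phi> has_real_derivative \<phi>' q) (at q)"
    and \<phi>': "\<And>q. q \<ge> 0 \<Longrightarrow> (\<phi>' has_real_derivative \<phi>'' q) (at q)"
  shows "laplacian (\<lambda>y. \<phi> ((norm y)\<^sup>2)) x =
    2 * real CARD('n) * \<phi>' ((norm x)\<^sup>2) + 4 * (norm x)\<^sup>2 * \<phi>'' ((norm x)\<^sup>2)"
proof -
  have line: "((\<lambda>h. (norm (y + h *\<^sub>R axis i 1))\<^sup>2) has_real_derivative 2 * y $ i) (at 0)"
    for y :: "real ^ 'n" and i
  proof -
    have "(norm (y + h *\<^sub>R axis i 1))\<^sup>2 = (norm y)\<^sup>2 + 2 * h * y $ i + h\<^sup>2" for h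
      unfolding power2_norm_eq_inner
      by (simp add: inner_add_left inner_add_right inner_axis inner_axis' inner_commute
          power2_eq_square algebra_simps)
    then show ?thesis by (auto intro!: derivative_eq_intros)
  qed
  have first: "partial_deriv i (\<lambda>y. \<phi> ((norm y)\<^sup>2)) y = \<phi>' ((norm y)\<^sup>2) * (2 * y $ i)"
    for y :: "real ^ 'n" and i
    unfolding partial_deriv_def
    by (rule DERIV_imp_deriv, rule DERIV_chain2[OF _ line]) (simp add: \<phi>)
  have "partial_deriv i (partial_deriv i (\<lambda>y. \<phi> ((norm y)\<^sup>2))) x =
      2 * \<phi>' ((norm x)\<^sup>2) + 4 * (x $ i)\<^sup>2 * \<phi>'' ((norm x)\<^sup>2)" for i
  proof -
    have "((\<lambda>h. \<phi>' ((norm (x + h *\<^sub>R axis i 1))\<^sup>2)) has_real_derivative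
        \<phi>'' ((norm x)\<^sup>2) * (2 * x $ i)) (at 0)"
      by (rule DERIV_chain2[OF _ line]) (simp add: \<phi>')
    moreover have "((\<lambda>h. 2 * (x + h *\<^sub>R axis i 1) $ i) has_real_derivative 2) (at 0)"
      by (auto intro!: derivative_eq_intros)
    ultimately have "((\<lambda>h. \<phi>' ((norm (x + h *\<^sub>R axis i 1))\<^sup>2) * (2 * (x + h *\<^sub>R axis i 1) $ i))
        has_real_derivative \<phi>'' ((norm x)\<^sup>2) * (2 * x $ i) * (2 * x $ i) +
          2 * \<phi>' ((norm x)\<^sup>2)) (at 0)"
      by (rule DERIV_cong[OF DERIV_mult]) simp
    then have "partial_deriv i (partial_deriv i (\<lambda>y. \<phi> ((norm y)\<^sup>2))) x =
        \<phi>'' ((norm x)\<^sup>2) * (2 * x $ i) * (2 * x $ i) + 2 * \<phi>' ((norm x)\<^sup>2)"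
      unfolding partial_deriv_def[of i "partial_deriv i _"] first by (rule DERIV_imp_deriv)
    then show ?thesis by (simp add: power2_eq_square)
  qed
  then have "laplacian (\<lambda>y. \<phi> ((norm y)\<^sup>2)) x =
      (\<Sum>i\<in>UNIV. 2 * \<phi>' ((norm x)\<^sup>2) + 4 * (x $ i)\<^sup>2 * \<phi>'' ((norm x)\<^sup>2))"
    unfolding laplacian_def by (rule sum.cong[OF refl])
  also have "\<dots> = real CARD('n) * (2 * \<phi>' ((norm x)\<^sup>2)) +
      4 * (\<Sum>i\<in>UNIV. (x $ i)\<^sup>2) * \<phi>'' ((norm x)\<^sup>2)"
    by (simp only: sum.distrib sum_constant sum_distrib_left sum_distrib_right)
  also have "(\<Sum>i\<in>UNIV. (x $ i)\<^sup>2) = (norm x)\<^sup>2"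
    unfolding power2_norm_eq_inner inner_vec_def by (simp add: power2_eq_square)
  finally show ?thesis by (simp only: mult_ac)
qed

section \<open>A supersolution of the one-dimensional model equation\<close>

text \<open>
  The function \<open>f\<close> of the introduction, with \<open>b / \<tau>\<close> written as \<open>b * \<tau> powr (- 1)\<close> in order that it
  is composed of powers and an exponential only. The first summand is of Gaussian type; the second
  one carries the algebraic decay in \<open>b\<close>.
\<close>

definition profile :: "real \<Rightarrow> real \<Rightarrow> real \<Rightarrow> real \<Rightarrow> real" where
  "profile \<beta> \<epsilon> \<tau> b = \<tau> powr (- \<beta>) * exp (- (b * \<tau> powr (- 1))) +
     \<epsilon> * ((\<tau> + b) powr (- \<beta>) + 2 * \<beta> * (\<beta> + 2) * (\<tau> * (\<tau> + b) powr (- \<beta> - 1)))"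

text \<open>The partial derivatives of \<open>profile\<close> in \<open>\<tau>\<close> and in \<open>b\<close>, and the second one in \<open>b\<close>.\<close>

definition profile_\<tau> :: "real \<Rightarrow> real \<Rightarrow> real \<Rightarrow> real \<Rightarrow> real" where
  "profile_\<tau> \<beta> \<epsilon> \<tau> b = \<tau> powr (- \<beta> - 1) * exp (- (b / \<tau>)) * (b / \<tau> - \<beta>) +
     \<epsilon> * (- \<beta> * (\<tau> + b) powr (- \<beta> - 1) +
       2 * \<beta> * (\<beta> + 2) * ((\<tau> + b) powr (- \<beta> - 1) - (\<beta> + 1) * \<tau> * (\<tau> + b) powr (- \<beta> - 2)))"

definition profile_b :: "real \<Rightarrow> real \<Rightarrow> real \<Rightarrow> real \<Rightarrow> real" where
  "profile_b \<beta> \<epsilon> \<tau> b = - (\<tau> powr (- \<beta> - 1) * exp (- (b / \<tau>))) -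
     \<epsilon> * (\<beta> * (\<tau> + b) powr (- \<beta> - 1) +
       2 * \<beta> * (\<beta> + 2) * (\<beta> + 1) * \<tau> * (\<tau> + b) powr (- \<beta> - 2))"

definition profile_bb :: "real \<Rightarrow> real \<Rightarrow> real \<Rightarrow> real \<Rightarrow> real" where
  "profile_bb \<beta> \<epsilon> \<tau> b = \<tau> powr (- \<beta> - 2) * exp (- (b / \<tau>)) +
     \<epsilon> * (\<beta> * (\<beta> + 1) * (\<tau> + b) powr (- \<beta> - 2) +
       2 * \<beta> * (\<beta> + 2) * (\<beta> + 1) * (\<beta> + 2) * \<tau> * (\<tau> + b) powr (- \<beta> - 3))"

lemma profile_eq:
  "\<tau> > 0 \<Longrightarrow> profile \<beta> \<epsilon> \<tau> b = \<tau> powr (- \<beta>) * exp (- (b / \<tau>)) +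
     \<epsilon> * ((\<tau> + b) powr (- \<beta>) + 2 * \<beta> * (\<beta> + 2) * (\<tau> * (\<tau> + b) powr (- \<beta> - 1)))"
  by (simp add: profile_def powr_minus_divide)

lemma has_real_derivative_powr_add:
  fixes x c a :: real
  assumes "x + c > 0"
  shows "((\<lambda>x. (x + c) powr a) has_real_derivative a * (x + c) powr (a - 1)) (at x)"
    and "((\<lambda>x. (c + x) powr a) has_real_derivative a * (c + x) powr (a - 1)) (at x)"
proof -
  show 1: "((\<lambda>x. (x + c) powr a) has_real_derivative a * (x + c) powr (a - 1)) (at x)"
    using DERIV_chain2[OF has_real_derivative_powr[OF assms] DERIV_add[OF DERIV_ident DERIV_const]]
    by simp
  then show "((\<lambda>x. (c + x) powr a) has_real_derivative a * (c + x) powr (a - 1)) (at x)"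
    by (simp add: add.commute)
qed

lemma has_real_derivative_profile_\<tau>:
  assumes "\<tau> > 0" "b \<ge> 0"
  shows "((\<lambda>\<tau>. profile \<beta> \<epsilon> \<tau> b) has_real_derivative profile_\<tau> \<beta> \<epsilon> \<tau> b) (at \<tau>)"
proof -
  have "\<tau> + b > 0" using assms by simp
  note dX = has_real_derivative_powr_add(1)[OF this]
  have p1: "\<tau> powr (- 1) = 1 / \<tau>" and p2: "\<tau> powr (- 1 - 1) = 1 / \<tau>\<^sup>2"
    using assms(1) by (simp_all add: powr_minus_divide)
  have pb: "\<tau> powr (- \<beta>) = \<tau> * \<tau> powr (- \<beta> - 1)"
    using assms(1) by (simp add: powr_diff)
  have E: "((\<lambda>\<tau>. exp (- (b * \<tau> powr (- 1)))) has_real_derivative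
      exp (- (b * \<tau> powr (- 1))) * - (b * (- 1 * \<tau> powr (- 1 - 1)))) (at \<tau>)"
    by (intro DERIV_chain2[OF DERIV_exp] DERIV_minus DERIV_cmult has_real_derivative_powr assms)
  have G: "((\<lambda>\<tau>. \<tau> powr (- \<beta>) * exp (- (b * \<tau> powr (- 1)))) has_real_derivative
      \<tau> powr (- \<beta> - 1) * exp (- (b / \<tau>)) * (b / \<tau> - \<beta>)) (at \<tau>)"
    by (rule DERIV_cong[OF DERIV_mult[OF has_real_derivative_powr[OF assms(1)] E]])
      (unfold p1 p2 pb, use assms(1) in \<open>simp add: field_simps power2_eq_square\<close>)
  show ?thesis
    unfolding profile_def profile_\<tau>_def
    by (rule DERIV_add[OF G DERIV_cmult],
        rule DERIV_cong[OF DERIV_add[OF dX DERIV_cmult[OF DERIV_mult[OF DERIV_ident dX]]]])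
      (simp add: algebra_simps)
qed

lemma has_real_derivative_profile_b:
  assumes "\<tau> > 0" "b \<ge> 0"
  shows "((\<lambda>b. profile \<beta> \<epsilon> \<tau> b) has_real_derivative profile_b \<beta> \<epsilon> \<tau> b) (at b)"
proof -
  have "b + \<tau> > 0" using assms by simp
  note dX = has_real_derivative_powr_add(2)[OF this]
  have E: "((\<lambda>b. exp (- (b / \<tau>))) has_real_derivative exp (- (b / \<tau>)) * - (1 / \<tau>)) (at b)"
    by (intro DERIV_chain2[OF DERIV_exp] DERIV_minus DERIV_cdivide DERIV_ident)
  have Y: "\<tau> powr (- \<beta> - 1) = \<tau> powr (- \<beta>) / \<tau>"
    using assms by (simp add: powr_diff)
  show ?thesis
    unfolding profile_eq[OF assms(1)]
    by (rule DERIV_cong[OF DERIV_add[OF DERIV_cmult[OF E]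
            DERIV_cmult[OF DERIV_add[OF dX DERIV_cmult[OF DERIV_cmult[OF dX]]]]]])
      (simp add: profile_b_def Y algebra_simps)
qed

lemma has_real_derivative_profile_bb:
  assumes "\<tau> > 0" "b \<ge> 0"
  shows "((\<lambda>b. profile_b \<beta> \<epsilon> \<tau> b) has_real_derivative profile_bb \<beta> \<epsilon> \<tau> b) (at b)"
proof -
  have "b + \<tau> > 0" using assms by simp
  note dX = has_real_derivative_powr_add(2)[OF this]
  have E: "((\<lambda>b. exp (- (b / \<tau>))) has_real_derivative exp (- (b / \<tau>)) * - (1 / \<tau>)) (at b)"
    by (intro DERIV_chain2[OF DERIV_exp] DERIV_minus DERIV_cdivide DERIV_ident)
  have Y: "\<tau> powr (- \<beta> - 2) = \<tau> powr (- \<beta> - 1) / \<tau>"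
    using assms powr_diff[of \<tau> "- \<beta> - 1" 1] by (simp add: diff_diff_eq)
  have e: "- \<beta> - 1 - 1 = - \<beta> - 2" "- \<beta> - 2 - 1 = - \<beta> - 3" by simp_all
  show ?thesis
    unfolding profile_b_def
    by (rule DERIV_cong[OF DERIV_diff[OF DERIV_minus[OF DERIV_cmult[OF E]]
            DERIV_cmult[OF DERIV_add[OF DERIV_cmult[OF dX] DERIV_cmult[OF dX]]]]])
      (simp add: profile_bb_def Y e algebra_simps)
qed

lemma profile_b_nonpos: "\<beta> > 0 \<Longrightarrow> \<epsilon> > 0 \<Longrightarrow> \<tau> > 0 \<Longrightarrow> profile_b \<beta> \<epsilon> \<tau> b \<le> 0"
  unfolding profile_b_def by (smt (verit) exp_gt_zero mult_nonneg_nonneg powr_ge_zero)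

lemma profile_bb_nonneg: "\<beta> > 0 \<Longrightarrow> \<epsilon> > 0 \<Longrightarrow> \<tau> > 0 \<Longrightarrow> profile_bb \<beta> \<epsilon> \<tau> b \<ge> 0"
  unfolding profile_bb_def by (intro add_nonneg_nonneg mult_nonneg_nonneg) auto

text \<open>
  The model inequality. In terms of \<open>w = \<tau> + b\<close> and \<open>z = \<tau> / w\<close>, the algebraic summand contributes at
  least \<open>\<epsilon> w powr (-\<beta> - 1) K (1 / 2 - (\<beta> + 1) (\<beta> + 3) z)\<close>, which is nonnegative for small \<open>z\<close>.
\<close>

lemma profile_supersolution:
  assumes "0 < \<beta>" "\<beta> < \<gamma>" "\<tau> > 0" "b \<ge> 0"
    and \<epsilon>: "\<epsilon> = (\<gamma> - \<beta>) * exp (- (2 * (\<beta> + 1) * (\<beta> + 3))) / (2 * \<beta> * (\<beta> + 2) * ((\<beta> + 1) * (\<beta> + 3)))"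
  shows "profile_\<tau> \<beta> \<epsilon> \<tau> b - \<gamma> * profile_b \<beta> \<epsilon> \<tau> b - b * profile_bb \<beta> \<epsilon> \<tau> b \<ge> 0"
proof -
  define w where "w = \<tau> + b"
  define P where "P = \<tau> powr (- \<beta> - 1)"
  define W where "W = w powr (- \<beta> - 1)"
  define K where "K = 2 * \<beta> * (\<beta> + 2)"
  define c where "c = (\<beta> + 1) * (\<beta> + 3)"
  define e where "e = exp (- (b / \<tau>))"
  define z where "z = \<tau> / w"
  have w: "w > 0" "\<tau> \<le> w" using assms unfolding w_def by auto
  have z: "0 < z" "z \<le> 1" using w assms(3) by (auto simp: z_def)
  have bw: "b / w = 1 - z" using w by (simp add: z_def w_def field_simps)
  have PW: "0 < W" "W \<le> P" "0 < P"
    using w assms unfolding P_def W_def by (auto intro!: powr_mono2')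
  have Kc: "K > 0" "c > 0" using assms(1) by (auto simp: K_def c_def)
  have \<epsilon>': "\<epsilon> = (\<gamma> - \<beta>) * exp (- (2 * c)) / (K * c)" "\<epsilon> > 0"
    using assms(1,2) unfolding \<epsilon> by (simp_all add: K_def c_def mult.assoc)
  have "w powr (- \<beta> - 1 - 1) = W / w" "w powr (- \<beta> - 1 - 1 - 1) = W / w / w"
    "\<tau> powr (- \<beta> - 1 - 1) = P / \<tau>"
    using w assms(3) by (simp_all only: powr_diff[of _ _ 1] W_def P_def powr_one)
  then have pw: "w powr (- \<beta> - 2) = W / w" "w powr (- \<beta> - 3) = W / w / w"
    "\<tau> powr (- \<beta> - 2) = P / \<tau>"
    by (simp_all add: diff_diff_eq)
  define rest where "rest = - \<beta> * W + K * (W - (\<beta> + 1) * \<tau> * (W / w)) +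
     \<gamma> * (\<beta> * W + K * (\<beta> + 1) * \<tau> * (W / w)) -
     b * (\<beta> * (\<beta> + 1) * (W / w) + K * (\<beta> + 1) * (\<beta> + 2) * \<tau> * (W / w / w))"
  have split: "profile_\<tau> \<beta> \<epsilon> \<tau> b - \<gamma> * profile_b \<beta> \<epsilon> \<tau> b - b * profile_bb \<beta> \<epsilon> \<tau> b =
      P * e * (\<gamma> - \<beta>) + \<epsilon> * rest"
    unfolding profile_\<tau>_def profile_b_def profile_bb_def w_def[symmetric] pw
      P_def[symmetric] W_def[symmetric] e_def[symmetric] K_def[symmetric] rest_def
    by (simp add: algebra_simps)
  have "rest = W * (- \<beta> + K * (1 - (\<beta> + 1) * z) + \<gamma> * (\<beta> + K * (\<beta> + 1) * z) -
      (b / w) * (\<beta> * (\<beta> + 1) + K * (\<beta> + 1) * (\<beta> + 2) * z))"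
    unfolding rest_def z_def by (simp add: algebra_simps add_divide_distrib)
  also have "\<dots> = W * (K / 2 - K * c * z) + W * (\<gamma> * (\<beta> + K * (\<beta> + 1) * z) +
      z * \<beta> * (\<beta> + 1) + z * z * K * (\<beta> + 1) * (\<beta> + 2))"
    unfolding bw K_def c_def by (simp add: algebra_simps)
  finally have rest: "rest \<ge> W * (K / 2 - K * c * z)"
    using assms(1,2) PW z Kc by (simp add: mult_nonneg_nonneg add_nonneg_nonneg)
  show ?thesis
  proof (cases "2 * c * z \<le> 1")
    case True
    then have "K * (2 * c * z) \<le> K * 1" using Kc by (intro mult_left_mono) auto
    then have "W * (K / 2 - K * c * z) \<ge> 0" using PW by (intro mult_nonneg_nonneg) auto
    then have "0 \<le> \<epsilon> * rest" using rest \<epsilon>'(2) by (intro mult_nonneg_nonneg) auto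
    then show ?thesis using PW assms(2) unfolding split e_def by simp
  next
    case False
    \<comment> \<open>Here \<open>b / \<tau>\<close> is bounded; \<open>\<epsilon>\<close> is such that the Gaussian summand compensates.\<close>
    have "b / \<tau> \<le> 2 * c"
    proof -
      have "w \<le> 2 * c * \<tau>" using False w by (simp add: z_def field_simps)
      then show ?thesis using assms(3) by (simp add: w_def field_simps)
    qed
    then have "exp (- (2 * c)) \<le> e" by (simp add: e_def)
    then have "P * exp (- (2 * c)) * (\<gamma> - \<beta>) \<le> P * e * (\<gamma> - \<beta>)"
      using PW assms(2) by (intro mult_right_mono mult_left_mono) auto
    moreover have "P * exp (- (2 * c)) * (\<gamma> - \<beta>) = \<epsilon> * (P * (K * c))"
      using Kc by (simp add: \<epsilon>')
    moreover have "W * (K * c) \<le> P * (K * c)" using PW Kc by simp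
    moreover have "- (W * (K * c)) \<le> rest"
    proof -
      have "W * (K * c * z) \<le> W * (K * c * 1)" using PW Kc z by (intro mult_left_mono) auto
      moreover have "0 \<le> W * (K / 2)" using PW Kc by simp
      ultimately show ?thesis using rest by (simp add: algebra_simps)
    qed
    ultimately have "\<epsilon> * (P * (K * c)) \<le> P * e * (\<gamma> - \<beta>)" "- (P * (K * c)) \<le> rest" by linarith+
    moreover from this(2) have "\<epsilon> * - (P * (K * c)) \<le> \<epsilon> * rest"
      using \<epsilon>'(2) by (intro mult_left_mono) auto
    ultimately show ?thesis unfolding split by simp
  qed
qed

lemma powr_exp_le:
  assumes "a > 0" "y \<ge> (0::real)"
  shows "(1 + y) powr a * exp (- y) \<le> a powr a * exp 1"
proof -
  have "((1 + y) / a) powr a \<le> exp ((1 + y) / a) powr a"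
    using assms exp_ge_add_one_self[of "(1 + y) / a"]
    by (intro powr_mono2; linarith?) (use assms in simp_all)
  also have "\<dots> = exp (1 + y)" using assms by (simp add: powr_def)
  finally have "(1 + y) powr a \<le> a powr a * exp (1 + y)"
    using assms by (simp add: powr_divide field_simps)
  then have "(1 + y) powr a * exp (- y) \<le> a powr a * exp (1 + y) * exp (- y)"
    by (intro mult_right_mono) auto
  also have "\<dots> = a powr a * exp 1" by (simp add: exp_add exp_minus)
  finally show ?thesis .
qed

text \<open>
  In terms of \<open>y = b / \<tau>\<close>, with \<open>\<tau> + b = \<tau> (1 + y)\<close>, exponential decay in \<open>y\<close> dominates every power of
  \<open>1 + y\<close>, so the Gaussian summand is at most a multiple of the algebraic one.
\<close>

lemma gaussian_le:
  assumes "a > 0" "m \<ge> 0" "\<tau> > 0" "b \<ge> (0::real)"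
  shows "\<tau> powr (- a) * exp (- (b / \<tau>)) * (1 + b / \<tau>) powr m \<le>
    ((a + m) powr (a + m) * exp 1) * (\<tau> + b) powr (- a)"
proof -
  have y: "b / \<tau> \<ge> 0" using assms by simp
  have "\<tau> + b = \<tau> * (1 + b / \<tau>)" using assms by (simp add: field_simps)
  then have "(\<tau> + b) powr (- a) = \<tau> powr (- a) * (1 + b / \<tau>) powr (- a)"
    using assms y by (simp add: powr_mult)
  moreover have "(1 + b / \<tau>) powr m = (1 + b / \<tau>) powr (- a) * (1 + b / \<tau>) powr (a + m)"
    using y by (simp add: powr_add[symmetric])
  ultimately have "\<tau> powr (- a) * exp (- (b / \<tau>)) * (1 + b / \<tau>) powr m =
      ((1 + b / \<tau>) powr (a + m) * exp (- (b / \<tau>))) * (\<tau> + b) powr (- a)"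
    by simp
  also have "\<dots> \<le> ((a + m) powr (a + m) * exp 1) * (\<tau> + b) powr (- a)"
    using assms y by (intro mult_right_mono powr_exp_le) auto
  finally show ?thesis .
qed

lemma mult_powr_minus_one_le:
  assumes "\<tau> > 0" "b \<ge> (0::real)"
  shows "\<tau> * (\<tau> + b) powr (a - 1) \<le> (\<tau> + b) powr a"
proof -
  have "\<tau> * (\<tau> + b) powr (a - 1) \<le> (\<tau> + b) * (\<tau> + b) powr (a - 1)"
    using assms by (intro mult_right_mono) auto
  also have "\<dots> = (\<tau> + b) powr a" using assms by (simp add: powr_diff)
  finally show ?thesis .
qed

lemma profile_lower_bound:
  assumes "\<beta> > 0" "\<epsilon> > 0" "\<tau> > 0" "b \<ge> 0"
  shows "\<epsilon> * (\<tau> + b) powr (- \<beta>) \<le> profile \<beta> \<epsilon> \<tau> b"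
proof -
  have "0 \<le> \<tau> powr (- \<beta>) * exp (- (b / \<tau>)) +
      \<epsilon> * (2 * \<beta> * (\<beta> + 2) * (\<tau> * (\<tau> + b) powr (- \<beta> - 1)))"
    using assms by (intro add_nonneg_nonneg mult_nonneg_nonneg) auto
  then show ?thesis by (simp add: profile_eq[OF assms(3)] distrib_left)
qed

lemma profile_upper_bound:
  assumes "\<beta> > 0" "\<epsilon> > 0"
  obtains C where "C > 0"
    "\<And>\<tau> b. \<tau> > 0 \<Longrightarrow> b \<ge> 0 \<Longrightarrow> profile \<beta> \<epsilon> \<tau> b \<le> C * (\<tau> + b) powr (- \<beta>)"
proof
  let ?C = "\<beta> powr \<beta> * exp 1 + \<epsilon> * (1 + 2 * \<beta> * (\<beta> + 2))"
  show "?C > 0" using assms by (intro add_pos_pos mult_pos_pos) auto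
  fix \<tau> b :: real assume \<tau>: "\<tau> > 0" "b \<ge> 0"
  have "1 + b / \<tau> > 0" using \<tau> by (simp add: add_pos_nonneg)
  then have "\<tau> powr (- \<beta>) * exp (- (b / \<tau>)) \<le> \<beta> powr \<beta> * exp 1 * (\<tau> + b) powr (- \<beta>)"
    using gaussian_le[OF assms(1) order_refl \<tau>] by simp
  moreover have "\<epsilon> * ((\<tau> + b) powr (- \<beta>) + 2 * \<beta> * (\<beta> + 2) * (\<tau> * (\<tau> + b) powr (- \<beta> - 1))) \<le>
      \<epsilon> * ((\<tau> + b) powr (- \<beta>) + 2 * \<beta> * (\<beta> + 2) * (\<tau> + b) powr (- \<beta>))"
    using assms by (intro mult_left_mono add_left_mono mult_powr_minus_one_le \<tau>) auto
  ultimately show "profile \<beta> \<epsilon> \<tau> b \<le> ?C * (\<tau> + b) powr (- \<beta>)"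
    unfolding profile_eq[OF \<tau>(1)] by (simp add: algebra_simps)
qed

lemma profile_\<tau>_bound:
  assumes "\<beta> > 0" "\<epsilon> > 0"
  obtains C where "C > 0"
    "\<And>\<tau> b. \<tau> > 0 \<Longrightarrow> b \<ge> 0 \<Longrightarrow> \<bar>profile_\<tau> \<beta> \<epsilon> \<tau> b\<bar> \<le> C * (\<tau> + b) powr (- \<beta> - 1)"
proof
  let ?K = "2 * \<beta> * (\<beta> + 2)"
  let ?G = "(\<beta> + 2) powr (\<beta> + 2) * exp 1"
  let ?C = "(1 + \<beta>) * ?G + \<epsilon> * (\<beta> + ?K * (\<beta> + 2))"
  show "?C > 0" using assms by (intro add_pos_pos mult_pos_pos) auto
  fix \<tau> b :: real assume \<tau>: "\<tau> > 0" "b \<ge> 0"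
  define W where "W = (\<tau> + b) powr (- \<beta> - 1)"
  define y where "y = b / \<tau>"
  have y: "y \<ge> 0" using \<tau> by (simp add: y_def)
  have exponent: "- (\<beta> + 1) = - \<beta> - 1" by simp
  have G: "\<tau> powr (- \<beta> - 1) * exp (- y) * (1 + y) \<le> ?G * W"
    using gaussian_le[of "\<beta> + 1" 1 \<tau> b, unfolded exponent] \<tau> assms y
    by (simp add: y_def W_def add.commute)
  have "\<bar>\<tau> powr (- \<beta> - 1) * exp (- y) * (y - \<beta>)\<bar> = \<tau> powr (- \<beta> - 1) * exp (- y) * \<bar>y - \<beta>\<bar>"
    by (simp add: abs_mult)
  also have "\<dots> \<le> \<tau> powr (- \<beta> - 1) * exp (- y) * ((1 + y) * (1 + \<beta>))"
    using y assms by (intro mult_left_mono) (auto simp: algebra_simps abs_le_iff add_nonneg_nonneg)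
  also have "\<dots> = (\<tau> powr (- \<beta> - 1) * exp (- y) * (1 + y)) * (1 + \<beta>)" by simp
  also have "\<dots> \<le> (?G * W) * (1 + \<beta>)" using G assms by (intro mult_right_mono) auto
  finally have 1: "\<bar>\<tau> powr (- \<beta> - 1) * exp (- y) * (y - \<beta>)\<bar> \<le> (1 + \<beta>) * ?G * W"
    by (simp add: mult_ac)
  define V where "V = \<tau> * (\<tau> + b) powr (- \<beta> - 2)"
  have V: "0 \<le> V" "V \<le> W"
    using mult_powr_minus_one_le[OF \<tau>, of "- \<beta> - 1"] \<tau> by (simp_all add: V_def W_def diff_diff_eq)
  have W: "W \<ge> 0" by (simp add: W_def)
  have K: "?K \<ge> 0" using assms by simp
  have "\<bar>- \<beta> * W + ?K * (W - (\<beta> + 1) * V)\<bar> \<le> \<bar>\<beta> * W\<bar> + \<bar>?K * (W - (\<beta> + 1) * V)\<bar>" by simp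
  also have "\<bar>?K * (W - (\<beta> + 1) * V)\<bar> \<le> ?K * ((\<beta> + 2) * W)"
  proof -
    have "(\<beta> + 1) * V \<le> (\<beta> + 1) * W" "0 \<le> (\<beta> + 1) * V" "0 \<le> \<beta> * W"
      using V W assms by (auto intro: mult_left_mono)
    then have "\<bar>W - (\<beta> + 1) * V\<bar> \<le> (\<beta> + 2) * W" using W by (simp add: algebra_simps abs_le_iff)
    then have "?K * \<bar>W - (\<beta> + 1) * V\<bar> \<le> ?K * ((\<beta> + 2) * W)" using K by (rule mult_left_mono)
    moreover have "\<bar>?K * (W - (\<beta> + 1) * V)\<bar> = ?K * \<bar>W - (\<beta> + 1) * V\<bar>"
      by (subst abs_mult, subst abs_of_nonneg[OF K], rule refl)
    ultimately show ?thesis by simp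
  qed
  finally have "\<bar>- \<beta> * W + ?K * (W - (\<beta> + 1) * V)\<bar> \<le> (\<beta> + ?K * (\<beta> + 2)) * W"
    using W assms by (simp add: algebra_simps)
  then have "\<epsilon> * \<bar>- \<beta> * W + ?K * (W - (\<beta> + 1) * V)\<bar> \<le> \<epsilon> * ((\<beta> + ?K * (\<beta> + 2)) * W)"
    using assms by (intro mult_left_mono) auto
  then have 2: "\<bar>\<epsilon> * (- \<beta> * W + ?K * (W - (\<beta> + 1) * V))\<bar> \<le> \<epsilon> * (\<beta> + ?K * (\<beta> + 2)) * W"
    using assms by (simp add: abs_mult mult.assoc)
  have "profile_\<tau> \<beta> \<epsilon> \<tau> b = \<tau> powr (- \<beta> - 1) * exp (- y) * (y - \<beta>) +
      \<epsilon> * (- \<beta> * W + ?K * (W - (\<beta> + 1) * V))"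
    by (simp add: profile_\<tau>_def y_def W_def V_def mult.assoc)
  then have "\<bar>profile_\<tau> \<beta> \<epsilon> \<tau> b\<bar> \<le> (1 + \<beta>) * ?G * W + \<epsilon> * (\<beta> + ?K * (\<beta> + 2)) * W"
    using 1 2 by linarith
  then show "\<bar>profile_\<tau> \<beta> \<epsilon> \<tau> b\<bar> \<le> ?C * (\<tau> + b) powr (- \<beta> - 1)"
    by (simp only: W_def distrib_right)
qed

section \<open>The spatial weight\<close>

text \<open>
  The weight \<open>A\<close> of the introduction as a function of \<open>q = |x|\<^sup>2\<close>: the summand with exponent
  \<open>p = 2 - \<alpha>\<close> is the leading one, and the other two are corrections of lower order. Its first and
  second derivative in \<open>q\<close> are \<open>weight'\<close> and \<open>weight''\<close>.
\<close>

definition weight :: "real \<Rightarrow> real \<Rightarrow> real \<Rightarrow> real \<Rightarrow> real \<Rightarrow> real \<Rightarrow> real" where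
  "weight p \<theta> \<kappa> \<Lambda> b q = b + \<kappa> * (1 + q) powr (p / 2) + \<Lambda> * (1 + q) powr (\<theta> / 2)"

definition weight' :: "real \<Rightarrow> real \<Rightarrow> real \<Rightarrow> real \<Rightarrow> real \<Rightarrow> real" where
  "weight' p \<theta> \<kappa> \<Lambda> q =
     \<kappa> * (p / 2 * (1 + q) powr (p / 2 - 1)) + \<Lambda> * (\<theta> / 2 * (1 + q) powr (\<theta> / 2 - 1))"

definition weight'' :: "real \<Rightarrow> real \<Rightarrow> real \<Rightarrow> real \<Rightarrow> real \<Rightarrow> real" where
  "weight'' p \<theta> \<kappa> \<Lambda> q =
     \<kappa> * (p / 2 * ((p / 2 - 1) * (1 + q) powr (p / 2 - 1 - 1))) +
     \<Lambda> * (\<theta> / 2 * ((\<theta> / 2 - 1) * (1 + q) powr (\<theta> / 2 - 1 - 1)))"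

lemma has_real_derivative_weight:
  assumes "q \<ge> 0"
  shows "(weight p \<theta> \<kappa> \<Lambda> b has_real_derivative weight' p \<theta> \<kappa> \<Lambda> q) (at q)"
    and "(weight' p \<theta> \<kappa> \<Lambda> has_real_derivative weight'' p \<theta> \<kappa> \<Lambda> q) (at q)"
proof -
  have "q + 1 > 0" using assms by simp
  note d = has_real_derivative_powr_add(2)[OF this]
  show "(weight p \<theta> \<kappa> \<Lambda> b has_real_derivative weight' p \<theta> \<kappa> \<Lambda> q) (at q)"
    unfolding weight_def[abs_def] weight'_def
    by (rule DERIV_cong[OF DERIV_add[OF DERIV_add[OF DERIV_const DERIV_cmult[OF d]]
            DERIV_cmult[OF d]]]) simp
  show "(weight' p \<theta> \<kappa> \<Lambda> has_real_derivative weight'' p \<theta> \<kappa> \<Lambda> q) (at q)"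
    unfolding weight'_def[abs_def] weight''_def
    by (intro DERIV_add DERIV_cmult d)
qed

text \<open>The Laplacian of \<open>(1 + |x|\<^sup>2) powr (m / 2)\<close> in dimension \<open>N\<close>, with \<open>s = 1 + |x|\<^sup>2\<close>.\<close>

definition power_laplacian :: "real \<Rightarrow> real \<Rightarrow> real \<Rightarrow> real" where
  "power_laplacian N m s = m * s powr (m / 2 - 1) * (N + m - 2 + (2 - m) / s)"

lemma weight_laplacian:
  assumes "q \<ge> 0"
  shows "2 * N * weight' p \<theta> \<kappa> \<Lambda> q + 4 * q * weight'' p \<theta> \<kappa> \<Lambda> q =
    \<kappa> * power_laplacian N p (1 + q) + \<Lambda> * power_laplacian N \<theta> (1 + q)"
proof -
  have "2 * N * (m / 2 * (1 + q) powr (m / 2 - 1)) +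
      4 * q * (m / 2 * ((m / 2 - 1) * (1 + q) powr (m / 2 - 1 - 1))) = power_laplacian N m (1 + q)"
    for m
  proof -
    have "(1 + q) powr (m / 2 - 1 - 1) = (1 + q) powr (m / 2 - 1) / (1 + q)"
      using assms powr_diff[of "1 + q" "m / 2 - 1" 1] by simp
    then show ?thesis using assms by (simp only: power_laplacian_def) (simp add: field_simps)
  qed
  note e = this[symmetric]
  show ?thesis unfolding weight'_def weight''_def e by (simp add: algebra_simps)
qed

text \<open>The condition on \<open>D\<close> at infinity in terms of the smooth function \<open>1 + |x|\<^sup>2\<close>.\<close>

lemma tendsto_diffusion_normalized:
  fixes D :: "real ^ 'n \<Rightarrow> real"
  assumes "((\<lambda>x. norm x powr (- \<alpha>) * D x) \<longlongrightarrow> D0) at_infinity"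
  shows "((\<lambda>x. (1 + (norm x)\<^sup>2) powr (- \<alpha> / 2) * D x) \<longlongrightarrow> D0) at_infinity"
proof -
  have "((\<lambda>r::real. r\<^sup>2 / (1 + r\<^sup>2)) \<longlongrightarrow> 1) at_top" by real_asymp
  then have "((\<lambda>x::real ^ 'n. (norm x)\<^sup>2 / (1 + (norm x)\<^sup>2)) \<longlongrightarrow> 1) at_infinity"
    by (rule filterlim_compose[OF _ filterlim_norm_at_top])
  then have "((\<lambda>x::real ^ 'n. ((norm x)\<^sup>2 / (1 + (norm x)\<^sup>2)) powr (\<alpha> / 2)) \<longlongrightarrow> 1 powr (\<alpha> / 2))
      at_infinity"
    by (intro tendsto_powr tendsto_const) auto
  from tendsto_mult[OF this assms]
  have "((\<lambda>x. ((norm x)\<^sup>2 / (1 + (norm x)\<^sup>2)) powr (\<alpha> / 2) * (norm x powr (- \<alpha>) * D x)) \<longlongrightarrow> D0)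
      at_infinity" by simp
  moreover have "((norm x)\<^sup>2 / (1 + (norm x)\<^sup>2)) powr (\<alpha> / 2) * (norm x powr (- \<alpha>) * D x) =
      (1 + (norm x)\<^sup>2) powr (- \<alpha> / 2) * D x" if "1 \<le> norm x" for x :: "real ^ 'n"
  proof -
    have x: "norm x > 0" using that by linarith
    then have "norm x powr 2 = (norm x)\<^sup>2" by (rule powr_numeral[OF less_imp_le])
    then have n: "((norm x)\<^sup>2) powr (\<alpha> / 2) = norm x powr \<alpha>"
      using powr_powr[of "norm x" 2 "\<alpha> / 2"] by simp
    have s: "(1 + (norm x)\<^sup>2) powr (- \<alpha> / 2) = inverse ((1 + (norm x)\<^sup>2) powr (\<alpha> / 2))"
      by (simp add: powr_minus)
    have "norm x powr \<alpha> * norm x powr (- \<alpha>) = 1"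
      using x by (simp add: powr_minus)
    moreover have "((norm x)\<^sup>2 / (1 + (norm x)\<^sup>2)) powr (\<alpha> / 2) * (norm x powr (- \<alpha>) * D x) =
        (norm x powr \<alpha> * norm x powr (- \<alpha>)) * ((1 + (norm x)\<^sup>2) powr (- \<alpha> / 2) * D x)"
      unfolding powr_divide n s
      by (simp only: divide_inverse mult_ac)
    ultimately show ?thesis by simp
  qed
  then have "eventually (\<lambda>x. ((norm x)\<^sup>2 / (1 + (norm x)\<^sup>2)) powr (\<alpha> / 2) *
      (norm x powr (- \<alpha>) * D x) = (1 + (norm x)\<^sup>2) powr (- \<alpha> / 2) * D x) at_infinity"
    unfolding eventually_at_infinity by blast
  ultimately show ?thesis by (rule Lim_transform_eventually)
qed

text \<open>
  The two bounds are \<open>D \<Delta>A \<ge> \<gamma>\<close> and \<open>D |\<nabla>A|\<^sup>2 \<le> A\<close> for \<open>A x = weight p \<theta> \<kappa> \<Lambda> b (|x|\<^sup>2)\<close>.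
  Inside a large ball \<open>\<Delta>A\<close> is made large by the choice of \<open>\<Lambda>\<close>, since \<open>(1 + |x|\<^sup>2) powr (\<theta> / 2)\<close> is
  strictly subharmonic for \<open>2 - N < \<theta> < 2\<close>; the gradient bound, which may then fail on a
  larger ball, is restored there by the additive constant \<open>b\<close>. At infinity the leading term decides.
\<close>

lemma weight_exists:
  fixes D :: "real ^ 'n \<Rightarrow> real"
  assumes D: "continuous_on UNIV D" "\<And>x. D x > 0"
    and "D0 > 0" and lim: "((\<lambda>x. norm x powr (- \<alpha>) * D x) \<longlongrightarrow> D0) at_infinity"
    and p: "p = 2 - \<alpha>" "p > 0"
    and \<gamma>: "0 < \<gamma>" "\<gamma> < (real CARD('n) - \<alpha>) / p"
  obtains \<theta> \<kappa> \<Lambda> b where "\<theta> \<le> p" "\<kappa> > 0" "\<Lambda> > 0" "b > 0"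
    "\<And>x. \<gamma> \<le> D x * (2 * real CARD('n) * weight' p \<theta> \<kappa> \<Lambda> ((norm x)\<^sup>2) +
      4 * (norm x)\<^sup>2 * weight'' p \<theta> \<kappa> \<Lambda> ((norm x)\<^sup>2))"
    "\<And>x. D x * (4 * (norm x)\<^sup>2 * (weight' p \<theta> \<kappa> \<Lambda> ((norm x)\<^sup>2))\<^sup>2) \<le>
      weight p \<theta> \<kappa> \<Lambda> b ((norm x)\<^sup>2)"
proof -
  define N where "N = real CARD('n)"
  define s where "s x = 1 + (norm x)\<^sup>2" for x :: "real ^ 'n"
  define E where "E x = s x powr (- \<alpha> / 2) * D x" for x
  have N: "N \<ge> 1" by (simp add: N_def Suc_leI)
  have s: "s x \<ge> 1" "s x > 0" for x by (simp_all add: s_def add_pos_nonneg)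
  have E: "(E \<longlongrightarrow> D0) at_infinity"
    using tendsto_diffusion_normalized[OF lim] by (simp add: E_def[abs_def] s_def)
  have Np: "N + p - 2 > 0" "\<gamma> < (N + p - 2) / p"
  proof -
    have "0 < (N - \<alpha>) / p" using \<gamma> by (simp add: N_def)
    then show "N + p - 2 > 0" using p by (simp add: zero_less_divide_iff)
    show "\<gamma> < (N + p - 2) / p" using \<gamma> p by (simp add: N_def)
  qed
  obtain \<theta> where \<theta>: "max 0 (2 - N) < \<theta>" "\<theta> < min 2 p"
    using dense[of "max 0 (2 - N)" "min 2 p"] N Np p by auto
  \<comment> \<open>\<open>h\<close> will be the limit of \<open>D |\<nabla>A|\<^sup>2 / (p A)\<close> at infinity, and that of \<open>D \<Delta>A\<close> is \<open>h (N + p - 2)\<close>.\<close>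
  obtain h where h: "\<gamma> / (N + p - 2) < h" "h < 1 / p"
    using dense[of "\<gamma> / (N + p - 2)" "1 / p"] Np p by (auto simp: field_simps)
  define \<kappa> where "\<kappa> = h / (p * D0)"
  have "0 < \<gamma> / (N + p - 2)" using Np \<gamma> by simp
  then have "h > 0" using h by linarith
  then have \<kappa>: "\<kappa> > 0" "\<gamma> < D0 * (\<kappa> * p * (N + p - 2))" "D0 * (\<kappa> * p\<^sup>2) < 1"
  proof -
    have e: "D0 * (\<kappa> * p * c) = h * c" for c using p \<open>D0 > 0\<close> by (simp add: \<kappa>_def)
    show "\<gamma> < D0 * (\<kappa> * p * (N + p - 2))"
      unfolding e using h(1) Np by (simp add: pos_divide_less_eq)
    show "D0 * (\<kappa> * p\<^sup>2) < 1"
    proof -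
      have "h * p < 1" using h(2) p(2) by (simp add: pos_less_divide_eq)
      then show ?thesis using e[of p] by (simp only: power2_eq_square mult.assoc)
    qed
    show "\<kappa> > 0" using p \<open>h > 0\<close> \<open>D0 > 0\<close> by (simp add: \<kappa>_def)
  qed

  have cont_s: "continuous_on A s" for A unfolding s_def by (intro continuous_intros)
  have s_nz: "s x \<noteq> 0" for x using s(2)[of x] by simp
  have cont_D: "continuous_on A D" for A using D(1) continuous_on_subset by blast
  have s_top: "filterlim s at_top at_infinity"
  proof -
    have "filterlim (\<lambda>r::real. 1 + r\<^sup>2) at_top at_top" by real_asymp
    then show ?thesis unfolding s_def by (rule filterlim_compose[OF _ filterlim_norm_at_top])
  qed
  have cont_lap: "continuous_on A (\<lambda>x. D x * power_laplacian N m (s x))" for A m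
    unfolding power_laplacian_def by (intro continuous_intros cont_s cont_D) (auto simp: s_nz)

  have "((\<lambda>x. (2 - p) / s x) \<longlongrightarrow> 0) at_infinity"
    by (rule tendsto_divide_0[OF tendsto_const filterlim_at_top_imp_at_infinity[OF s_top]])
  then have "((\<lambda>x. E x * (\<kappa> * p * (N + p - 2 + (2 - p) / s x))) \<longlongrightarrow>
      D0 * (\<kappa> * p * (N + p - 2 + 0))) at_infinity"
    by (intro tendsto_mult tendsto_add tendsto_const E)
  then have "eventually (\<lambda>x. \<gamma> < E x * (\<kappa> * p * (N + p - 2 + (2 - p) / s x))) at_infinity"
    by (rule order_tendstoD) (use \<kappa> in simp)
  then obtain R0 where R0: "\<And>x. R0 \<le> norm x \<Longrightarrow> \<gamma> < E x * (\<kappa> * p * (N + p - 2 + (2 - p) / s x))"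
    unfolding eventually_at_infinity by blast
  have lap_p: "D x * (\<kappa> * power_laplacian N p (s x)) = E x * (\<kappa> * p * (N + p - 2 + (2 - p) / s x))" for x
  proof -
    have "p / 2 - 1 = - \<alpha> / 2" using p(1) by (simp add: field_simps)
    then show ?thesis unfolding power_laplacian_def E_def by (simp add: mult_ac)
  qed
  have lap_\<theta>: "power_laplacian N \<theta> (s x) > 0" for x
  proof -
    have "0 < \<theta>" "0 < N + \<theta> - 2" "0 < (2 - \<theta>) / s x" using \<theta> s[of x] by auto
    then show ?thesis
      unfolding power_laplacian_def using s(2)[of x] by (intro mult_pos_pos add_pos_pos) auto
  qed

  \<comment> \<open>\<open>R0\<close> does not depend on \<open>\<Lambda>\<close>, which can thus be chosen according to the ball of that radius.\<close>
  obtain m where m: "m > 0" "\<And>x. x \<in> cball 0 \<bar>R0\<bar> \<Longrightarrow> m \<le> D x * power_laplacian N \<theta> (s x)"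
  proof -
    have "cball (0::real ^ 'n) \<bar>R0\<bar> \<noteq> {}" by simp
    from continuous_attains_inf[OF compact_cball this cont_lap[of _ \<theta>]]
    obtain x where "\<forall>y\<in>cball 0 \<bar>R0\<bar>. D x * power_laplacian N \<theta> (s x) \<le> D y * power_laplacian N \<theta> (s y)"
      by blast
    then show ?thesis using that D(2)[of x] lap_\<theta>[of x] mult_pos_pos by blast
  qed
  obtain M where M: "\<And>x. x \<in> cball 0 \<bar>R0\<bar> \<Longrightarrow> - M \<le> D x * (\<kappa> * power_laplacian N p (s x))" "M > 0"
  proof -
    have "bounded ((\<lambda>x. D x * power_laplacian N p (s x)) ` cball 0 \<bar>R0\<bar>)"
      by (intro compact_imp_bounded compact_continuous_image cont_lap compact_cball)
    then obtain a where a: "a > 0" "\<And>x. x \<in> cball 0 \<bar>R0\<bar> \<Longrightarrow> \<bar>D x * power_laplacian N p (s x)\<bar> \<le> a"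
      unfolding bounded_pos by auto
    have "- (\<kappa> * a) \<le> D x * (\<kappa> * power_laplacian N p (s x))" if "x \<in> cball 0 \<bar>R0\<bar>" for x
    proof -
      have "\<kappa> * - a \<le> \<kappa> * (D x * power_laplacian N p (s x))"
        using a(2)[OF that] \<kappa> by (intro mult_left_mono) auto
      then show ?thesis by (simp add: mult_ac)
    qed
    then show ?thesis using that \<kappa> a mult_pos_pos by blast
  qed
  define \<Lambda> where "\<Lambda> = (M + \<gamma>) / m"
  have \<Lambda>: "\<Lambda> > 0" using M \<gamma> m by (simp add: \<Lambda>_def)
  have lap: "\<gamma> \<le> D x * (2 * N * weight' p \<theta> \<kappa> \<Lambda> ((norm x)\<^sup>2) +
      4 * (norm x)\<^sup>2 * weight'' p \<theta> \<kappa> \<Lambda> ((norm x)\<^sup>2))" for x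
  proof -
    have "\<gamma> \<le> D x * (\<kappa> * power_laplacian N p (s x)) + \<Lambda> * (D x * power_laplacian N \<theta> (s x))"
    proof (cases "R0 \<le> norm x")
      case True
      then have "\<gamma> \<le> D x * (\<kappa> * power_laplacian N p (s x))" unfolding lap_p using R0 by fastforce
      moreover have "0 \<le> \<Lambda> * (D x * power_laplacian N \<theta> (s x))"
        using \<Lambda> D(2)[of x] lap_\<theta>[of x] by simp
      ultimately show ?thesis by linarith
    next
      case False
      then have x: "x \<in> cball 0 \<bar>R0\<bar>" by simp
      have "M + \<gamma> = \<Lambda> * m" using m by (simp add: \<Lambda>_def)
      also have "\<dots> \<le> \<Lambda> * (D x * power_laplacian N \<theta> (s x))"
        using m(2)[OF x] \<Lambda> by (intro mult_left_mono) auto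
      finally show ?thesis using M(1)[OF x] by linarith
    qed
    then show ?thesis
      unfolding weight_laplacian[OF zero_le_power2] by (simp add: s_def algebra_simps)
  qed

  \<comment> \<open>The gradient bound holds for large \<open>|x|\<close>, even without the additive constant.\<close>
  have "((\<lambda>x. s x powr ((\<theta> - p) / 2)) \<longlongrightarrow> 0) at_infinity"
    using \<theta> by (intro tendsto_neg_powr s_top) auto
  then have "((\<lambda>x. E x * (\<kappa> * p + \<Lambda> * \<theta> * s x powr ((\<theta> - p) / 2))\<^sup>2) \<longlongrightarrow>
      D0 * (\<kappa> * p + \<Lambda> * \<theta> * 0)\<^sup>2) at_infinity"
    by (intro tendsto_intros E)
  moreover have "D0 * (\<kappa> * p + \<Lambda> * \<theta> * 0)\<^sup>2 < \<kappa>"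
    using mult_strict_left_mono[OF \<kappa>(3,1)] by (simp add: power2_eq_square mult_ac)
  ultimately have "eventually (\<lambda>x. E x * (\<kappa> * p + \<Lambda> * \<theta> * s x powr ((\<theta> - p) / 2))\<^sup>2 < \<kappa>) at_infinity"
    by (rule order_tendstoD)
  then obtain R1 where R1: "\<And>x. R1 \<le> norm x \<Longrightarrow>
      E x * (\<kappa> * p + \<Lambda> * \<theta> * s x powr ((\<theta> - p) / 2))\<^sup>2 < \<kappa>"
    unfolding eventually_at_infinity by blast
  define G where "G x = D x * (4 * (norm x)\<^sup>2 * (weight' p \<theta> \<kappa> \<Lambda> ((norm x)\<^sup>2))\<^sup>2)" for x
  have G_le: "G x \<le> \<kappa> * s x powr (p / 2)" if "R1 \<le> norm x" for x
  proof -
    define H where "H = \<kappa> * p + \<Lambda> * \<theta> * s x powr ((\<theta> - p) / 2)"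
    have "s x powr (\<theta> / 2 - 1) = s x powr (p / 2 - 1) * s x powr ((\<theta> - p) / 2)"
      by (simp add: powr_add[symmetric] diff_divide_distrib)
    then have w': "2 * weight' p \<theta> \<kappa> \<Lambda> ((norm x)\<^sup>2) = s x powr (p / 2 - 1) * H"
      unfolding weight'_def H_def s_def[symmetric] by (simp add: algebra_simps)
    have "G x = D x * ((norm x)\<^sup>2 * (2 * weight' p \<theta> \<kappa> \<Lambda> ((norm x)\<^sup>2))\<^sup>2)"
      by (simp add: G_def power_mult_distrib)
    also have "\<dots> \<le> D x * (s x * (s x powr (p / 2 - 1) * H)\<^sup>2)"
      unfolding w' using D(2)[of x] by (intro mult_left_mono mult_right_mono) (auto simp: s_def)
    also have "\<dots> = s x powr (p / 2) * (E x * H\<^sup>2)"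
    proof -
      define e where "e = p / 2 - 1"
      have "p / 2 + - \<alpha> / 2 = 1 + e + e" using p(1) by (simp add: e_def field_simps)
      then have "s x powr (p / 2) * s x powr (- \<alpha> / 2) = s x powr (1 + e + e)"
        by (simp only: powr_add[symmetric])
      also have "\<dots> = s x * (s x powr e)\<^sup>2"
        unfolding powr_add power2_eq_square using s(2)[of x] by simp
      finally have S: "s x * (s x powr e)\<^sup>2 = s x powr (p / 2) * s x powr (- \<alpha> / 2)" ..
      have "D x * (s x * (s x powr e * H)\<^sup>2) = D x * H\<^sup>2 * (s x * (s x powr e)\<^sup>2)"
        by (simp only: power_mult_distrib mult_ac)
      then show ?thesis unfolding S unfolding e_def E_def by (simp only: mult_ac)
    qed
    also have "\<dots> \<le> s x powr (p / 2) * \<kappa>"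
      using R1[OF that] by (intro mult_left_mono) (auto simp: H_def)
    finally show ?thesis by (simp add: mult.commute)
  qed
  have "bounded (G ` cball 0 \<bar>R1\<bar>)"
  proof (intro compact_imp_bounded compact_continuous_image compact_cball)
    show "continuous_on (cball 0 \<bar>R1\<bar>) G"
      unfolding G_def weight'_def s_def[symmetric]
      by (intro continuous_intros cont_s cont_D) (auto simp: s_nz)
  qed
  then obtain b where b: "b > 0" "\<And>x. x \<in> cball 0 \<bar>R1\<bar> \<Longrightarrow> \<bar>G x\<bar> \<le> b"
    unfolding bounded_pos by auto
  have grad: "G x \<le> weight p \<theta> \<kappa> \<Lambda> b ((norm x)\<^sup>2)" for x
  proof -
    have "G x \<le> b + \<kappa> * s x powr (p / 2)"
    proof (cases "R1 \<le> norm x")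
      case False
      then have "\<bar>G x\<bar> \<le> b" using b by simp
      moreover have "0 \<le> \<kappa> * s x powr (p / 2)" using \<kappa> by simp
      ultimately show ?thesis by linarith
    qed (use G_le[of x] b in simp)
    moreover have "0 \<le> \<Lambda> * s x powr (\<theta> / 2)" using \<Lambda> by simp
    ultimately show ?thesis unfolding weight_def s_def by linarith
  qed
  have "\<theta> \<le> p" using \<theta> by simp
  from that[OF this \<kappa>(1) \<Lambda> b(1) lap[unfolded N_def] grad[unfolded G_def]] show ?thesis .
qed

lemma weight_bounds:
  assumes "q \<ge> 0" "\<theta> \<le> p" "\<kappa> > 0" "\<Lambda> > 0" "b > 0" "p > 0"
  shows "\<kappa> * (1 + q) powr (p / 2) \<le> weight p \<theta> \<kappa> \<Lambda> b q"
    and "weight p \<theta> \<kappa> \<Lambda> b q \<le> (b + \<kappa> + \<Lambda>) * (1 + q) powr (p / 2)"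
proof -
  show "\<kappa> * (1 + q) powr (p / 2) \<le> weight p \<theta> \<kappa> \<Lambda> b q"
    using assms by (simp add: weight_def)
  have "b * 1 \<le> b * (1 + q) powr (p / 2)"
    using assms by (intro mult_left_mono ge_one_powr_ge_zero) auto
  moreover have "\<Lambda> * (1 + q) powr (\<theta> / 2) \<le> \<Lambda> * (1 + q) powr (p / 2)"
    using assms by (intro mult_left_mono powr_mono) auto
  ultimately show "weight p \<theta> \<kappa> \<Lambda> b q \<le> (b + \<kappa> + \<Lambda>) * (1 + q) powr (p / 2)"
    by (simp add: weight_def distrib_right)
qed

section \<open>The supersolution\<close>

lemma Ck_upto_norm_fst:
  "Ck_upto k S T (\<lambda>z::(real ^ 'n) \<times> real. (norm (fst z))\<^sup>2)"
proof -
  have "bounded_linear (\<lambda>z::(real ^ 'n) \<times> real. fst z $ i)" for i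
    using bounded_linear_compose[OF bounded_linear_vec_nth bounded_linear_fst] .
  then have "Ck_upto k S T (\<lambda>z::(real ^ 'n) \<times> real. \<Sum>i\<in>UNIV. fst z $ i * fst z $ i)"
    by (intro Ck_upto_sum Ck_upto_mult Ck_upto_bounded_linear) auto
  then show ?thesis unfolding power2_norm_eq_inner inner_vec_def by simp
qed

text \<open>The supersolution is smooth for \<open>t > -1\<close>, since there \<open>1 + t > 0\<close> and the weight is positive.\<close>

lemma Ck_upto_profile_weight:
  assumes "b > 0" "\<kappa> > 0" "\<Lambda> > 0"
  shows "Ck_upto k (UNIV \<times> {-1<..}) (UNIV \<times> {-1<..})
    (\<lambda>z::(real ^ 'n) \<times> real. M * profile \<beta> \<epsilon> (1 + snd z) (weight p \<theta> \<kappa> \<Lambda> b ((norm (fst z))\<^sup>2)))"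
    (is "Ck_upto k ?W ?W _")
proof -
  have s: "1 + (norm x)\<^sup>2 > 0" for x :: "real ^ 'n" by (simp add: add_pos_nonneg)
  have w: "weight p \<theta> \<kappa> \<Lambda> b ((norm x)\<^sup>2) > 0" for x :: "real ^ 'n"
    unfolding weight_def using assms by (intro add_pos_nonneg) auto
  have weight: "Ck_upto k ?W ?W (\<lambda>z. weight p \<theta> \<kappa> \<Lambda> b ((norm (fst z))\<^sup>2))"
    unfolding weight_def
    by (intro Ck_upto_add Ck_upto_mult Ck_upto_const Ck_upto_powr Ck_upto_norm_fst order_refl s)
  have time: "Ck_upto k ?W ?W (\<lambda>z. 1 + snd z)"
    by (intro Ck_upto_add Ck_upto_const Ck_upto_bounded_linear bounded_linear_snd)
  have sum: "Ck_upto k ?W ?W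
      (\<lambda>z. 1 + snd z + weight p \<theta> \<kappa> \<Lambda> b ((norm (fst z))\<^sup>2))"
    by (rule Ck_upto_add[OF time weight])
  have time_powr: "Ck_upto k ?W ?W (\<lambda>z. (1 + snd z) powr a)" for a
    by (rule Ck_upto_powr[OF time]) auto
  have sum_powr: "Ck_upto k ?W ?W
      (\<lambda>z. (1 + snd z + weight p \<theta> \<kappa> \<Lambda> b ((norm (fst z))\<^sup>2)) powr a)" for a
    by (rule Ck_upto_powr[OF sum]) (auto simp: add_pos_pos w)
  have "Ck_upto k ?W ?W
      (\<lambda>z. (- 1) * (weight p \<theta> \<kappa> \<Lambda> b ((norm (fst z))\<^sup>2) * (1 + snd z) powr (- 1)))"
    by (rule Ck_upto_mult[OF Ck_upto_const Ck_upto_mult[OF weight time_powr]])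
  from Ck_upto_exp[OF this order_refl]
  have gauss: "Ck_upto k ?W ?W
      (\<lambda>z. exp (- (weight p \<theta> \<kappa> \<Lambda> b ((norm (fst z))\<^sup>2) * (1 + snd z) powr (- 1))))"
    by simp
  show ?thesis
    unfolding profile_def
    by (rule Ck_upto_mult[OF Ck_upto_const Ck_upto_add[OF Ck_upto_mult[OF time_powr gauss]
            Ck_upto_mult[OF Ck_upto_const Ck_upto_add[OF sum_powr
              Ck_upto_mult[OF Ck_upto_const Ck_upto_mult[OF time sum_powr]]]]]])
qed

theorem theorem1p2:
  fixes \<Omega> :: "(real ^ 'n) set" and D :: "real ^ 'n \<Rightarrow> real" and \<alpha> D\<^sub>0 \<sigma> :: real
  assumes "exterior_domain \<Omega>"
    and "\<alpha> < min 2 (real CARD('n))"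
    and "continuous_on UNIV D" and "\<And>x. D x > 0"
    and "D\<^sub>0 > 0" and "((\<lambda>x. norm x powr (- \<alpha>) * D x) \<longlongrightarrow> D\<^sub>0) at_infinity"
    and "0 < \<sigma>" and "\<sigma> < (real CARD('n) - \<alpha>) / 2"
  shows "\<exists>U. supersolution \<Omega> D (\<lambda>x. japanese x powr (- 2 * \<sigma>)) U \<and>
    (\<exists>c>0. \<exists>C>0. \<exists>C'>0. \<forall>x\<in>closure \<Omega>. \<forall>t\<ge>0.
       c * (1 + t + japanese x powr (2 - \<alpha>)) powr (- (2 * \<sigma> / (2 - \<alpha>))) \<le> U (x, t) \<and>
       U (x, t) \<le> C * (1 + t + japanese x powr (2 - \<alpha>)) powr (- (2 * \<sigma> / (2 - \<alpha>))) \<and>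
       \<bar>time_deriv U x t\<bar>
         \<le> C' * (1 + t + japanese x powr (2 - \<alpha>)) powr (- (2 * \<sigma> / (2 - \<alpha>)) - 1))"
proof -
  define p where "p = 2 - \<alpha>"
  define \<beta> where "\<beta> = 2 * \<sigma> / p"
  have p: "p > 0" using assms(2) by (simp add: p_def)
  have \<beta>: "\<beta> > 0" using p assms(7) by (simp add: \<beta>_def)
  have "\<beta> < (real CARD('n) - \<alpha>) / p"
    unfolding \<beta>_def using assms(8) p by (intro divide_strict_right_mono) auto
  then obtain \<gamma> where \<gamma>: "\<beta> < \<gamma>" "\<gamma> < (real CARD('n) - \<alpha>) / p" using dense by blast
  have "0 < \<gamma>" using \<beta> \<gamma> by simp
  obtain \<theta> \<kappa> \<Lambda> b where \<theta>: "\<theta> \<le> p" and \<kappa>: "\<kappa> > 0" "\<Lambda> > 0" "b > 0"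
    and lap: "\<And>x. \<gamma> \<le> D x * (2 * real CARD('n) * weight' p \<theta> \<kappa> \<Lambda> ((norm x)\<^sup>2) +
      4 * (norm x)\<^sup>2 * weight'' p \<theta> \<kappa> \<Lambda> ((norm x)\<^sup>2))"
    and grad: "\<And>x. D x * (4 * (norm x)\<^sup>2 * (weight' p \<theta> \<kappa> \<Lambda> ((norm x)\<^sup>2))\<^sup>2) \<le>
      weight p \<theta> \<kappa> \<Lambda> b ((norm x)\<^sup>2)"
    using weight_exists[OF assms(3-6) p_def p \<open>0 < \<gamma>\<close> \<gamma>(2)] by blast
  define A where "A = weight p \<theta> \<kappa> \<Lambda> b"
  define \<epsilon> where "\<epsilon> = (\<gamma> - \<beta>) * exp (- (2 * (\<beta> + 1) * (\<beta> + 3))) /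
    (2 * \<beta> * (\<beta> + 2) * ((\<beta> + 1) * (\<beta> + 3)))"
  have \<epsilon>: "\<epsilon> > 0" using \<beta> \<gamma>(1) by (simp add: \<epsilon>_def)
  define k where "k = min 1 \<kappa>"
  define m where "m = max 1 (b + \<kappa> + \<Lambda>)"
  have km: "k > 0" "m > 0" using \<kappa> by (auto simp: k_def m_def)
  define P where "P x t = 1 + t + japanese x powr p" for x :: "real ^ 'n" and t
  \<comment> \<open>The factor \<open>M\<close> makes the initial value large enough.\<close>
  define M where "M = (2 * m) powr \<beta> / \<epsilon>"
  have M: "M > 0" using \<epsilon> km by (simp add: M_def)
  define U where "U z = M * profile \<beta> \<epsilon> (1 + snd z) (A ((norm (fst z))\<^sup>2))"
    for z :: "(real ^ 'n) \<times> real"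
  have jap: "japanese x powr a = (1 + (norm x)\<^sup>2) powr (a / 2)" for x :: "real ^ 'n" and a
    by (simp add: japanese_def powr_half_sqrt[symmetric] powr_powr add_nonneg_nonneg)
  have A_bounds: "\<kappa> * japanese x powr p \<le> A ((norm x)\<^sup>2)"
    "A ((norm x)\<^sup>2) \<le> (b + \<kappa> + \<Lambda>) * japanese x powr p" for x :: "real ^ 'n"
    unfolding jap A_def using \<theta> \<kappa> p by (simp_all add: weight_bounds)
  have A_nonneg: "A q \<ge> 0" if "q \<ge> 0" for q
    unfolding A_def weight_def using \<kappa> by simp
  have P_pos: "P x t > 0" if "t \<ge> 0" for x t
    using that by (simp add: P_def add_pos_nonneg)
  have comparable: "k * P x t \<le> 1 + t + A ((norm x)\<^sup>2)" "1 + t + A ((norm x)\<^sup>2) \<le> m * P x t"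
    if "t \<ge> 0" for x t
  proof -
    have j: "0 \<le> japanese x powr p" by simp
    have "k * (1 + t) \<le> 1 * (1 + t)" "k * japanese x powr p \<le> \<kappa> * japanese x powr p"
      using that j by (intro mult_right_mono; simp add: k_def)+
    then show "k * P x t \<le> 1 + t + A ((norm x)\<^sup>2)"
      using A_bounds(1)[of x] by (simp add: P_def algebra_simps)
    have "1 * (1 + t) \<le> m * (1 + t)" "(b + \<kappa> + \<Lambda>) * japanese x powr p \<le> m * japanese x powr p"
      using that j by (intro mult_right_mono; simp add: m_def)+
    then show "1 + t + A ((norm x)\<^sup>2) \<le> m * P x t"
      using A_bounds(2)[of x] by (simp add: P_def algebra_simps)
  qed
  have powr_comparable: "m powr (- a) * P x t powr (- a) \<le> (1 + t + A ((norm x)\<^sup>2)) powr (- a)"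
    "(1 + t + A ((norm x)\<^sup>2)) powr (- a) \<le> k powr (- a) * P x t powr (- a)"
    if "t \<ge> 0" "a > 0" for x t a
  proof -
    have "1 + t + A ((norm x)\<^sup>2) > 0" "k * P x t > 0"
      using that km P_pos[of t x] A_nonneg[of "(norm x)\<^sup>2"] by (auto intro: add_pos_nonneg)
    then have "(m * P x t) powr (- a) \<le> (1 + t + A ((norm x)\<^sup>2)) powr (- a)"
      "(1 + t + A ((norm x)\<^sup>2)) powr (- a) \<le> (k * P x t) powr (- a)"
      using comparable[OF that(1)] that by (auto intro!: powr_mono2')
    then show "m powr (- a) * P x t powr (- a) \<le> (1 + t + A ((norm x)\<^sup>2)) powr (- a)"
      "(1 + t + A ((norm x)\<^sup>2)) powr (- a) \<le> k powr (- a) * P x t powr (- a)"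
      using km P_pos[OF that(1), of x] by (simp_all add: powr_mult)
  qed

  have lower: "M * \<epsilon> * m powr (- \<beta>) * P x t powr (- \<beta>) \<le> U (x, t)" if "t \<ge> 0" for x t
  proof -
    have "\<epsilon> * (m powr (- \<beta>) * P x t powr (- \<beta>)) \<le> \<epsilon> * (1 + t + A ((norm x)\<^sup>2)) powr (- \<beta>)"
      using \<epsilon> powr_comparable(1)[OF that \<beta>] by (intro mult_left_mono) auto
    also have "\<dots> \<le> profile \<beta> \<epsilon> (1 + t) (A ((norm x)\<^sup>2))"
      using that A_nonneg by (intro profile_lower_bound \<beta> \<epsilon>) auto
    finally have "M * (\<epsilon> * (m powr (- \<beta>) * P x t powr (- \<beta>))) \<le> M * profile \<beta> \<epsilon> (1 + t) (A ((norm x)\<^sup>2))"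
      using M by (intro mult_left_mono) auto
    then show ?thesis by (simp add: U_def mult_ac)
  qed

  obtain C where C: "C > 0"
    "\<And>\<tau> b. \<tau> > 0 \<Longrightarrow> b \<ge> 0 \<Longrightarrow> profile \<beta> \<epsilon> \<tau> b \<le> C * (\<tau> + b) powr (- \<beta>)"
    using profile_upper_bound[OF \<beta> \<epsilon>] by blast
  have upper: "U (x, t) \<le> M * C * k powr (- \<beta>) * P x t powr (- \<beta>)" if "t \<ge> 0" for x t
  proof -
    have "profile \<beta> \<epsilon> (1 + t) (A ((norm x)\<^sup>2)) \<le> C * (1 + t + A ((norm x)\<^sup>2)) powr (- \<beta>)"
      using that A_nonneg by (intro C(2)) auto
    also have "\<dots> \<le> C * (k powr (- \<beta>) * P x t powr (- \<beta>))"
      using C(1) powr_comparable(2)[OF that \<beta>] by (intro mult_left_mono) auto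
    finally have "M * profile \<beta> \<epsilon> (1 + t) (A ((norm x)\<^sup>2)) \<le> M * (C * (k powr (- \<beta>) * P x t powr (- \<beta>)))"
      using M by (intro mult_left_mono) auto
    then show ?thesis by (simp add: U_def mult_ac)
  qed

  have U_t: "time_deriv U x t = M * profile_\<tau> \<beta> \<epsilon> (1 + t) (A ((norm x)\<^sup>2))" if "t \<ge> 0" for x t
  proof -
    have "((\<lambda>t. profile \<beta> \<epsilon> (1 + t) (A ((norm x)\<^sup>2))) has_real_derivative
        profile_\<tau> \<beta> \<epsilon> (1 + t) (A ((norm x)\<^sup>2))) (at t)"
      using DERIV_chain2[OF has_real_derivative_profile_\<tau> DERIV_add[OF DERIV_const DERIV_ident]]
        that A_nonneg by simp
    then have "((\<lambda>t. U (x, t)) has_real_derivative M * profile_\<tau> \<beta> \<epsilon> (1 + t) (A ((norm x)\<^sup>2))) (at t)"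
      unfolding U_def fst_conv snd_conv by (rule DERIV_cmult)
    then have "((\<lambda>t. U (x, t)) has_vector_derivative M * profile_\<tau> \<beta> \<epsilon> (1 + t) (A ((norm x)\<^sup>2)))
        (at t within {0..})"
      by (simp add: has_real_derivative_iff_has_vector_derivative has_vector_derivative_at_within)
    moreover have "at t within {0..} \<noteq> bot"
    proof -
      have "at_right t \<le> at t within {0..}" using that by (intro at_le) auto
      then show ?thesis using trivial_limit_at_right_real[of t] by (metis bot.extremum_uniqueI)
    qed
    ultimately show ?thesis unfolding time_deriv_def by (intro vector_derivative_within)
  qed

  obtain C' where C': "C' > 0" "\<And>\<tau> b. \<tau> > 0 \<Longrightarrow> b \<ge> 0 \<Longrightarrow>
      \<bar>profile_\<tau> \<beta> \<epsilon> \<tau> b\<bar> \<le> C' * (\<tau> + b) powr (- \<beta> - 1)"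
    using profile_\<tau>_bound[OF \<beta> \<epsilon>] by blast
  have U_t_bound: "\<bar>time_deriv U x t\<bar> \<le> M * C' * k powr (- \<beta> - 1) * P x t powr (- \<beta> - 1)"
    if "t \<ge> 0" for x t
  proof -
    have exponent: "- (\<beta> + 1) = - \<beta> - 1" by simp
    have "\<bar>profile_\<tau> \<beta> \<epsilon> (1 + t) (A ((norm x)\<^sup>2))\<bar> \<le> C' * (1 + t + A ((norm x)\<^sup>2)) powr (- \<beta> - 1)"
      using that A_nonneg by (intro C'(2)) auto
    also have "\<dots> \<le> C' * (k powr (- \<beta> - 1) * P x t powr (- \<beta> - 1))"
      using C'(1) \<beta> powr_comparable(2)[OF that, of "\<beta> + 1" x, unfolded exponent]
      by (intro mult_left_mono) auto
    finally have "M * \<bar>profile_\<tau> \<beta> \<epsilon> (1 + t) (A ((norm x)\<^sup>2))\<bar> \<le>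
        M * (C' * (k powr (- \<beta> - 1) * P x t powr (- \<beta> - 1)))"
      using M by (intro mult_left_mono) auto
    then show ?thesis using M by (simp add: U_t[OF that] abs_mult mult_ac)
  qed

  have equation: "time_deriv U x t - D x * laplacian (\<lambda>y. U (y, t)) x \<ge> 0" if "t > 0" for x t
  proof -
    define q where "q = (norm x)\<^sup>2"
    define f\<^sub>b where "f\<^sub>b = profile_b \<beta> \<epsilon> (1 + t)"
    define f\<^sub>b\<^sub>b where "f\<^sub>b\<^sub>b = profile_bb \<beta> \<epsilon> (1 + t)"
    define A' where "A' = weight' p \<theta> \<kappa> \<Lambda>"
    define A'' where "A'' = weight'' p \<theta> \<kappa> \<Lambda>"
    have t: "1 + t > 0" using that by simp
    have dA: "(A has_real_derivative A' r) (at r)" "(A' has_real_derivative A'' r) (at r)"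
      if "r \<ge> 0" for r
      unfolding A_def A'_def A''_def using has_real_derivative_weight[OF that] by auto
    have d1: "((\<lambda>r. M * profile \<beta> \<epsilon> (1 + t) (A r)) has_real_derivative M * (f\<^sub>b (A r) * A' r)) (at r)"
      if "r \<ge> 0" for r
      unfolding f\<^sub>b_def
      by (intro DERIV_cmult DERIV_chain2[OF has_real_derivative_profile_b dA(1)] t A_nonneg that)
    have d2: "((\<lambda>r. M * (f\<^sub>b (A r) * A' r)) has_real_derivative
        M * (f\<^sub>b (A r) * A'' r + f\<^sub>b\<^sub>b (A r) * A' r * A' r)) (at r)"
      if "r \<ge> 0" for r
      unfolding f\<^sub>b_def f\<^sub>b\<^sub>b_def
      by (intro DERIV_cmult DERIV_mult' DERIV_chain2[OF has_real_derivative_profile_bb dA(1)]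
          dA t A_nonneg that)
    have "laplacian (\<lambda>y. U (y, t)) x = 2 * real CARD('n) * (M * (f\<^sub>b (A q) * A' q)) +
        4 * q * (M * (f\<^sub>b (A q) * A'' q + f\<^sub>b\<^sub>b (A q) * A' q * A' q))"
      unfolding U_def fst_conv snd_conv q_def
      by (rule laplacian_radial[where \<phi> = "\<lambda>r. M * profile \<beta> \<epsilon> (1 + t) (A r)"]) (fact d1 d2)+
    then have "time_deriv U x t - D x * laplacian (\<lambda>y. U (y, t)) x =
        M * (profile_\<tau> \<beta> \<epsilon> (1 + t) (A q) -
          f\<^sub>b (A q) * (D x * (2 * real CARD('n) * A' q + 4 * q * A'' q)) -
          f\<^sub>b\<^sub>b (A q) * (D x * (4 * q * (A' q)\<^sup>2)))"
      using that by (simp add: U_t q_def algebra_simps power2_eq_square)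
    moreover have "M * (profile_\<tau> \<beta> \<epsilon> (1 + t) (A q) - f\<^sub>b (A q) * \<gamma> - f\<^sub>b\<^sub>b (A q) * A q) \<le>
        M * (profile_\<tau> \<beta> \<epsilon> (1 + t) (A q) -
          f\<^sub>b (A q) * (D x * (2 * real CARD('n) * A' q + 4 * q * A'' q)) -
          f\<^sub>b\<^sub>b (A q) * (D x * (4 * q * (A' q)\<^sup>2)))"
    proof (rule mult_left_mono, rule diff_mono, rule diff_mono, rule order_refl)
      show "f\<^sub>b (A q) * (D x * (2 * real CARD('n) * A' q + 4 * q * A'' q)) \<le> f\<^sub>b (A q) * \<gamma>"
        using lap[of x] profile_b_nonpos[OF \<beta> \<epsilon> t]
        by (intro mult_left_mono_neg) (auto simp: f\<^sub>b_def A'_def A''_def q_def)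
      show "f\<^sub>b\<^sub>b (A q) * (D x * (4 * q * (A' q)\<^sup>2)) \<le> f\<^sub>b\<^sub>b (A q) * A q"
        using grad[of x] profile_bb_nonneg[OF \<beta> \<epsilon> t]
        by (intro mult_left_mono) (auto simp: f\<^sub>b\<^sub>b_def A_def A'_def q_def)
    qed (use M in auto)
    moreover have "0 \<le> M * (profile_\<tau> \<beta> \<epsilon> (1 + t) (A q) - f\<^sub>b (A q) * \<gamma> - f\<^sub>b\<^sub>b (A q) * A q)"
      using profile_supersolution[OF \<beta> \<gamma>(1) t A_nonneg[of q] \<epsilon>_def] M
      by (intro mult_nonneg_nonneg) (auto simp: f\<^sub>b_def f\<^sub>b\<^sub>b_def q_def mult.commute)
    ultimately show ?thesis by linarith
  qed

  have initial: "japanese x powr (- 2 * \<sigma>) \<le> U (x, 0)" for x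
  proof -
    define J where "J = japanese x powr p"
    have "J \<ge> 1" unfolding J_def jap using p by (intro ge_one_powr_ge_zero) auto
    have "japanese x powr (- 2 * \<sigma>) = J powr (- \<beta>)"
      using p by (simp add: J_def \<beta>_def powr_powr)
    also have "\<dots> = 2 powr \<beta> * (2 * J) powr (- \<beta>)"
      using \<open>J \<ge> 1\<close> by (simp add: powr_mult powr_minus)
    also have "\<dots> \<le> 2 powr \<beta> * P x 0 powr (- \<beta>)"
      using \<open>J \<ge> 1\<close> \<beta> by (intro mult_left_mono powr_mono2') (auto simp: P_def J_def)
    also have "2 powr \<beta> = M * \<epsilon> * m powr (- \<beta>)"
      using \<epsilon> km by (simp add: M_def powr_mult powr_minus)
    also have "M * \<epsilon> * m powr (- \<beta>) * P x 0 powr (- \<beta>) \<le> U (x, 0)" by (rule lower) simp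
    finally show ?thesis .
  qed

  have U_nonneg: "U (x, t) \<ge> 0" if "t > 0" for x t
  proof -
    have "0 \<le> M * \<epsilon> * m powr (- \<beta>) * P x t powr (- \<beta>)"
      using M \<epsilon> by (intro mult_nonneg_nonneg) auto
    then show ?thesis using lower[of t x] that by simp
  qed
  have "Ck_upto 2 (\<Omega> \<times> {0<..}) (closure \<Omega> \<times> {0..}) U"
    unfolding U_def A_def
    by (rule Ck_upto_restrict[OF Ck_upto_profile_weight[OF \<kappa>(3,1,2)]]) auto
  then have super: "supersolution \<Omega> D (\<lambda>x. japanese x powr (- 2 * \<sigma>)) U"
    unfolding supersolution_def using equation initial U_nonneg by blast
  have constants: "M * \<epsilon> * m powr (- \<beta>) > 0" "M * C * k powr (- \<beta>) > 0"
    "M * C' * k powr (- \<beta> - 1) > 0"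
    using M \<epsilon> km C(1) C'(1) by (intro mult_pos_pos; simp)+
  show ?thesis
    unfolding p_def[symmetric] \<beta>_def[symmetric] P_def[symmetric]
  proof (rule exI[of _ U], rule conjI[OF super], rule exI, rule conjI[OF constants(1)],
      rule exI, rule conjI[OF constants(2)], rule exI, rule conjI[OF constants(3)],
      intro ballI allI impI conjI)
    fix x :: "real ^ 'n" and t :: real
    assume "t \<ge> 0"
    then show "M * \<epsilon> * m powr (- \<beta>) * P x t powr (- \<beta>) \<le> U (x, t)"
      and "U (x, t) \<le> M * C * k powr (- \<beta>) * P x t powr (- \<beta>)"
      and "\<bar>time_deriv U x t\<bar> \<le> M * C' * k powr (- \<beta> - 1) * P x t powr (- \<beta> - 1)"
      by (fact lower upper U_t_bound)+
  qed
qed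

end
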